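(* The set $\{t_1^{c_1}\cdots t_n^{c_n}g_w : w\in\mathfrak S(n),\ 0\le c_1,\ldots,c_n\le r-1\}$ is an $R$-basis of $\mathcal H_{n,r}$.
   Context: Standing setup: $R$ is an integral domain, $n\ge 1$, $r\ge 1$, and $q,u_1,\ldots,u_r\in R$ with $q$ invertible in $R$ and $\Delta:=\prod_{1\le j<i\le r}(u_i-u_j)$ invertible in $R$. For $1\le c\le r$ let $F_c(X)\in R[X]$ be the unique polynomial of degree $\le r-1$ with $F_c(u_{c'})=\delta_{c,c'}\Delta$ for all $1\le c'\le r$. The modified Ariki–Koike (Shoji) algebra $\mathcal H_{n,r}=\mathcal H_{n,r}(R,q,u_1,\ldots,u_r)$ is the associative $R$-algebra generated by $t_1,\ldots,t_n,T_1,\ldots,T_{n-1}$ subject to: $(T_i-q)(T_i+q^{-1})=0$; $(t_i-u_1)\cdots(t_i-u_r)=0$; $T_iT_{i+1}T_i=T_{i+1}T_iT_{i+1}$; $T_iT_j=T_jT_i$ for $|i-j|\ge2$; $t_it_j=t_jt_i$; $T_jt_k=t_kT_j$ for $k\ne j,j+1$; and for $2\le j\le n$: $T_{j-1}t_j=t_{j-1}T_{j-1}+\Delta^{-2}\sum_{1\le c_1<c_2\le r}(u_{c_2}-u_{c_1})(q-q^{-1})F_{c_1}(t_{j-1})F_{c_2}(t_j)$ and $T_{j-1}t_{j-1}=t_jT_{j-1}-\Delta^{-2}\sum_{1\le c_1<c_2\le r}(u_{c_2}-u_{c_1})(q-q^{-1})F_{c_1}(t_{j-1})F_{c_2}(t_j)$.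 It is known (Shoji) that $\{t_1^{c_1}\cdots t_n^{c_n}T_w\}$ ($w\in\mathfrak S(n)$, $0\le c_i\le r-1$) is an $R$-basis. Write $[1,r]=\{1,\ldots,r\}$; for $\mathbf k=(k_1,\ldots,k_n)\in[1,r]^n$ set $b_{\mathbf k}:=\prod_{i=1}^n\prod_{1\le j\le r,\,j\ne k_i}\frac{t_i-u_j}{u_{k_i}-u_j}$. For $1\le i,j\le n$ let $B'_{i,j}:=-(q-q^{-1})\sum_{\mathbf k,\ k_i<k_j}b_{\mathbf k}$; for $1\le i\le n-1$ let $g_i:=T_i+B'_{i,i+1}$. For $w\in\mathfrak S(n)$ with reduced expression $w=s_{i_1}\cdots s_{i_l}$, $T_w:=T_{i_1}\cdots T_{i_l}$ and $g_w:=g_{i_1}\cdots g_{i_l}$ (independent of the reduced expression). *)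

theory Defs
  imports "HOL-Computational_Algebra.Polynomial" "HOL-Combinatorics.Permutations"
          "HOL-Library.FuncSet"
begin

definition rinv :: "'r::comm_ring_1 \<Rightarrow> 'r" where
  "rinv x = (THE y. x * y = 1)"

definition Delta :: "nat \<Rightarrow> (nat \<Rightarrow> 'r::comm_ring_1) \<Rightarrow> 'r" where
  "Delta r u = (\<Prod>(i,j)\<in>{(i,j). 1 \<le> j \<and> j < i \<and> i \<le> r}. u i - u j)"

definition Fpol :: "nat \<Rightarrow> (nat \<Rightarrow> 'r::idom) \<Rightarrow> nat \<Rightarrow> 'r poly" where
  "Fpol r u c = (THE p. degree p \<le> r - 1 \<and>
      (\<forall>c'\<in>{1..r}. poly p (u c') = (if c = c' then Delta r u else 0)))"

datatype gen = Gt nat | GT nat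

definition valid_gen :: "nat \<Rightarrow> gen \<Rightarrow> bool" where
  "valid_gen n g = (case g of Gt i \<Rightarrow> 1 \<le> i \<and> i \<le> n | GT i \<Rightarrow> 1 \<le> i \<and> i \<le> n - 1)"

(* elements: R-valued coefficient functions on words *)
type_synonym 'r fa = "gen list \<Rightarrow> 'r"

definition fa_carrier :: "nat \<Rightarrow> ('r::comm_ring_1) fa set" where
  "fa_carrier n = {p. finite {w. p w \<noteq> 0} \<and> (\<forall>w. p w \<noteq> 0 \<longrightarrow> (\<forall>g\<in>set w. valid_gen n g))}"

definition fa_add :: "('r::comm_ring_1) fa \<Rightarrow> 'r fa \<Rightarrow> 'r fa" where
  "fa_add p q = (\<lambda>w. p w + q w)"

definition fa_minus :: "('r::comm_ring_1) fa \<Rightarrow> 'r fa \<Rightarrow> 'r fa" where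
  "fa_minus p q = (\<lambda>w. p w - q w)"

definition fa_smul :: "'r::comm_ring_1 \<Rightarrow> 'r fa \<Rightarrow> 'r fa" where
  "fa_smul a p = (\<lambda>w. a * p w)"

definition fa_mult :: "('r::comm_ring_1) fa \<Rightarrow> 'r fa \<Rightarrow> 'r fa" where
  "fa_mult p q = (\<lambda>w. \<Sum>k\<le>length w. p (take k w) * q (drop k w))"

definition fa_one :: "('r::comm_ring_1) fa" where
  "fa_one = (\<lambda>w. if w = [] then 1 else 0)"

definition fa_scal :: "'r::comm_ring_1 \<Rightarrow> 'r fa" where
  "fa_scal a = fa_smul a fa_one"

definition fa_gen :: "gen \<Rightarrow> ('r::comm_ring_1) fa" where
  "fa_gen g = (\<lambda>w. if w = [g] then 1 else 0)"

definition fa_sum :: "('i \<Rightarrow> ('r::comm_ring_1) fa) \<Rightarrow> 'i set \<Rightarrow> 'r fa" where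
  "fa_sum f A = (\<lambda>w. \<Sum>x\<in>A. f x w)"

definition fa_prod :: "('r::comm_ring_1) fa list \<Rightarrow> 'r fa" where
  "fa_prod xs = foldr fa_mult xs fa_one"

definition fa_pow :: "('r::comm_ring_1) fa \<Rightarrow> nat \<Rightarrow> 'r fa" where
  "fa_pow x k = fa_prod (replicate k x)"

definition fa_poly :: "('r::comm_ring_1) poly \<Rightarrow> 'r fa \<Rightarrow> 'r fa" where
  "fa_poly p x = fa_sum (\<lambda>i. fa_smul (coeff p i) (fa_pow x i)) {..degree p}"

abbreviation tg :: "nat \<Rightarrow> ('r::comm_ring_1) fa" where "tg i \<equiv> fa_gen (Gt i)"
abbreviation Tg :: "nat \<Rightarrow> ('r::comm_ring_1) fa" where "Tg i \<equiv> fa_gen (GT i)"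

inductive_set fa_ideal :: "nat \<Rightarrow> ('r::comm_ring_1) fa set \<Rightarrow> 'r fa set" for n S where
  zero: "(\<lambda>_. 0) \<in> fa_ideal n S"
| gen: "s \<in> S \<Longrightarrow> a \<in> fa_carrier n \<Longrightarrow> b \<in> fa_carrier n \<Longrightarrow> fa_mult (fa_mult a s) b \<in> fa_ideal n S"
| add: "x \<in> fa_ideal n S \<Longrightarrow> y \<in> fa_ideal n S \<Longrightarrow> fa_add x y \<in> fa_ideal n S"

definition corr :: "nat \<Rightarrow> 'r::idom \<Rightarrow> (nat \<Rightarrow> 'r) \<Rightarrow> nat \<Rightarrow> 'r fa" where
  "corr r q u j = fa_sum (\<lambda>(c1,c2). fa_smul (rinv (Delta r u) ^ 2 * (u c2 - u c1) * (q - rinv q))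
       (fa_mult (fa_poly (Fpol r u c1) (tg (j - 1))) (fa_poly (Fpol r u c2) (tg j))))
     {(c1,c2). 1 \<le> c1 \<and> c1 < c2 \<and> c2 \<le> r}"

definition hrel :: "nat \<Rightarrow> nat \<Rightarrow> 'r::idom \<Rightarrow> (nat \<Rightarrow> 'r) \<Rightarrow> 'r fa set" where
  "hrel n r q u =
     {fa_mult (fa_minus (Tg i) (fa_scal q)) (fa_add (Tg i) (fa_scal (rinv q))) | i. 1 \<le> i \<and> i \<le> n - 1}
   \<union> {fa_prod (map (\<lambda>c. fa_minus (tg i) (fa_scal (u c))) [1..<r+1]) | i. 1 \<le> i \<and> i \<le> n}
   \<union> {fa_minus (fa_prod [Tg i, Tg (i+1), Tg i]) (fa_prod [Tg (i+1), Tg i, Tg (i+1)])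
       | i. 1 \<le> i \<and> i + 1 \<le> n - 1}
   \<union> {fa_minus (fa_mult (Tg i) (Tg j)) (fa_mult (Tg j) (Tg i))
       | i j. 1 \<le> i \<and> i \<le> n - 1 \<and> 1 \<le> j \<and> j \<le> n - 1 \<and> (i + 2 \<le> j \<or> j + 2 \<le> i)}
   \<union> {fa_minus (fa_mult (tg i) (tg j)) (fa_mult (tg j) (tg i)) | i j. 1 \<le> i \<and> i \<le> n \<and> 1 \<le> j \<and> j \<le> n}
   \<union> {fa_minus (fa_mult (Tg j) (tg k)) (fa_mult (tg k) (Tg j))
       | j k. 1 \<le> j \<and> j \<le> n - 1 \<and> 1 \<le> k \<and> k \<le> n \<and> k \<noteq> j \<and> k \<noteq> j + 1}
   \<union> {fa_minus (fa_minus (fa_mult (Tg (j-1)) (tg j)) (fa_mult (tg (j-1)) (Tg (j-1)))) (corr r q u j)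
       | j. 2 \<le> j \<and> j \<le> n}
   \<union> {fa_add (fa_minus (fa_mult (Tg (j-1)) (tg (j-1))) (fa_mult (tg j) (Tg (j-1)))) (corr r q u j)
       | j. 2 \<le> j \<and> j \<le> n}"

(* the defining ideal of H_{n,r}; H_{n,r} = fa_carrier n / H_ideal n r q u *)
definition H_ideal :: "nat \<Rightarrow> nat \<Rightarrow> 'r::idom \<Rightarrow> (nat \<Rightarrow> 'r) \<Rightarrow> 'r fa set" where
  "H_ideal n r q u = fa_ideal n (hrel n r q u)"

(* b_k for k in [1,r]^n, product ordered by i then j ascending (commuting factors in H) *)
definition bk :: "nat \<Rightarrow> nat \<Rightarrow> (nat \<Rightarrow> 'r::idom) \<Rightarrow> (nat \<Rightarrow> nat) \<Rightarrow> 'r fa" where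
  "bk n r u k = fa_prod (concat (map (\<lambda>i. map (\<lambda>j. fa_smul (rinv (u (k i) - u j)) (fa_minus (tg i) (fa_scal (u j))))
        (filter (\<lambda>j. j \<noteq> k i) [1..<r+1])) [1..<n+1]))"

definition Bp :: "nat \<Rightarrow> nat \<Rightarrow> 'r::idom \<Rightarrow> (nat \<Rightarrow> 'r) \<Rightarrow> nat \<Rightarrow> nat \<Rightarrow> 'r fa" where
  "Bp n r q u i j = fa_smul (- (q - rinv q)) (fa_sum (bk n r u) {k \<in> {1..n} \<rightarrow>\<^sub>E {1..r}. k i < k j})"

definition gg :: "nat \<Rightarrow> nat \<Rightarrow> 'r::idom \<Rightarrow> (nat \<Rightarrow> 'r) \<Rightarrow> nat \<Rightarrow> 'r fa" where
  "gg n r q u i = fa_add (Tg i) (Bp n r q u i (i + 1))"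

definition perm_of_word :: "nat list \<Rightarrow> nat \<Rightarrow> nat" where
  "perm_of_word l = foldr (\<lambda>i f. transpose i (i + 1) \<circ> f) l id"

definition reduced_word :: "nat \<Rightarrow> nat list \<Rightarrow> (nat \<Rightarrow> nat) \<Rightarrow> bool" where
  "reduced_word n l w = (set l \<subseteq> {1..n-1} \<and> perm_of_word l = w \<and>
      (\<forall>l'. set l' \<subseteq> {1..n-1} \<and> perm_of_word l' = w \<longrightarrow> length l \<le> length l'))"

definition gw :: "nat \<Rightarrow> nat \<Rightarrow> 'r::idom \<Rightarrow> (nat \<Rightarrow> 'r) \<Rightarrow> (nat \<Rightarrow> nat) \<Rightarrow> 'r fa" where
  "gw n r q u w = fa_prod (map (gg n r q u) (SOME l. reduced_word n l w))"

definition mon :: "nat \<Rightarrow> nat \<Rightarrow> 'r::idom \<Rightarrow> (nat \<Rightarrow> 'r) \<Rightarrow> (nat \<Rightarrow> nat) \<times> (nat \<Rightarrow> nat) \<Rightarrow> 'r fa" where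
  "mon n r q u cw = fa_mult (fa_prod (map (\<lambda>i. fa_pow (tg i) (fst cw i)) [1..<n+1])) (gw n r q u (snd cw))"

definition Idx :: "nat \<Rightarrow> nat \<Rightarrow> ((nat \<Rightarrow> nat) \<times> (nat \<Rightarrow> nat)) set" where
  "Idx n r = ({1..n} \<rightarrow>\<^sub>E {0..<r}) \<times> {w. w permutes {1..n}}"

end

theory Submission
  imports Defs
begin

text \<open>
  The algebra acts on functions on words of letters (colour, label): \<open>t\<^sub>i\<close> multiplies by \<open>u\<close> of the
  \<open>i\<close>-th colour, and \<open>T\<^sub>i\<close> swaps the letters at \<open>i\<close> and \<open>i + 1\<close>, with a correction by \<open>q - q\<inverse>\<close> when
  they are ascending for a total order of the letters. In this action \<open>g\<^sub>i\<close> keeps the correction only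
  for letters of equal colour. Hence, applied to the sum \<open>v\<^sub>0\<close> of all words labelled by the identity,
  \<open>g\<^sub>w\<close> yields exactly the sum of all words labelled by \<open>w\<inverse>\<close>, and since the Vandermonde matrix of
  the \<open>u\<^sub>c\<close> is invertible, the elements \<open>t\<^sup>c g\<^sub>w v\<^sub>0\<close> form a basis of the representation.

  It remains to see that \<open>x \<mapsto> x v\<^sub>0\<close> is injective on the algebra. The elements \<open>t\<^sup>c T\<^sub>l\<close>, for \<open>l\<close> in a set
  of normal form words of the symmetric group, span the algebra, and their images are independent
  because \<open>T\<^sub>l v\<^sub>0\<close> is unitriangular with respect to length. No braid relation between the \<open>g\<^sub>i\<close> and no
  independence of the reduced expression is needed.
\<close>

section \<open>The free algebra\<close>

text \<open>The vector \<open>v0\<close> does two jobs: it reads off \<open>g\<close>-coordinates,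
  and it separates the \<open>t\<close>-\<open>T\<close> normal forms modulo the ideal. Joining
  both, an element that kills \<open>v0\<close> on \<open>states\<close> lies in the ideal. Labels
  are compared in reverse at equal colours. Along a reduced word the labels ascend at the place
  about to be swapped, so the equal-colour correction, which wants a descent, never fires for
  \<open>g\<close>. \<open>T\<close> keeps a correction at rising colours as well, but such a term
  leaves the labels where they are and adds no inversion; this is the source of the triangularity.
  Labels are kept distinct because two equal adjacent letters would in general break the quadratic
  relation. So the operators act on all functions, while the relations are claimed only at arguments
  in \<open>states\<close>, and stability of that set under the generators carries them to the whole
  ideal. Inverse permutations appear because functions are acted on: a generator precomposes the
  state with a swap of positions.\<close>

lemma fa_mult_Nil [simp]: "fa_mult p q [] = p [] * q []"
  by (simp add: fa_mult_def)

text \<open>The cut before the first letter is singled out; all others are cuts of \<open>w\<close>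
  for the left factor translated by \<open>x\<close>. Induction on the word with arbitrary left
  factor then gives associativity and the right unit law.\<close>

lemma fa_mult_Cons:
  "fa_mult p q (x # w) = p [] * q (x # w) + fa_mult (\<lambda>v. p (x # v)) q w"
  by (simp add: fa_mult_def sum.atMost_Suc_shift del: sum.atMost_Suc)

lemma fa_mult_one_left: "fa_mult fa_one p = p"
proof
  fix w :: "gen list"
  have "fa_mult (\<lambda>v. fa_one (x # v)) p w = 0" for x w
    by (simp add: fa_mult_def fa_one_def)
  then show "fa_mult fa_one p w = p w"
    by (cases w) (simp_all add: fa_mult_Cons, simp_all add: fa_one_def)
qed

lemma fa_mult_one_right: "fa_mult p fa_one = p"
proof
  fix w :: "gen list"
  show "fa_mult p fa_one w = p w"
    by (induction w arbitrary: p) (simp_all add: fa_mult_Cons, simp_all add: fa_one_def)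
qed

lemma fa_mult_add_left: "fa_mult (\<lambda>w. p w + q w) s w = fa_mult p s w + fa_mult q s w"
  by (simp add: fa_mult_def algebra_simps sum.distrib)

lemma fa_mult_add_right: "fa_mult s (\<lambda>w. p w + q w) w = fa_mult s p w + fa_mult s q w"
  by (simp add: fa_mult_def algebra_simps sum.distrib)

lemma fa_mult_smul_left: "fa_mult (\<lambda>w. a * p w) q w = a * fa_mult p q w"
  by (simp add: fa_mult_def sum_distrib_left mult.assoc)

lemma fa_mult_smul_right: "fa_mult p (\<lambda>w. a * q w) w = a * fa_mult p q w"
  by (simp add: fa_mult_def sum_distrib_left algebra_simps)

lemma fa_mult_assoc: "fa_mult (fa_mult p q) s = fa_mult p (fa_mult q s)"
proof
  fix w :: "gen list"
  show "fa_mult (fa_mult p q) s w = fa_mult p (fa_mult q s) w"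
  proof (induction w arbitrary: p)
    case (Cons x w)
    have "(\<lambda>v. fa_mult p q (x # v)) = (\<lambda>v. p [] * q (x # v) + fa_mult (\<lambda>v. p (x # v)) q v)"
      by (simp add: fa_mult_Cons)
    then show ?case
      using Cons by (simp add: fa_mult_Cons fa_mult_add_left fa_mult_smul_left algebra_simps)
  qed (simp add: mult.assoc)
qed

text \<open>The Cauchy product is defined on all coefficient functions, so these form a ring containing
  the free algebra; a type of its own gives access to the \<open>ring_1\<close> simplification rules.\<close>

typedef 'r ncser = "UNIV :: (gen list \<Rightarrow> 'r) set" morphisms coef ser
  by simp

setup_lifting type_definition_ncser

instantiation ncser :: (comm_ring_1) ring_1
begin

lift_definition zero_ncser :: "'a ncser" is "\<lambda>_. 0" .
lift_definition one_ncser :: "'a ncser" is fa_one .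
lift_definition plus_ncser :: "'a ncser \<Rightarrow> 'a ncser \<Rightarrow> 'a ncser" is fa_add .
lift_definition minus_ncser :: "'a ncser \<Rightarrow> 'a ncser \<Rightarrow> 'a ncser" is fa_minus .
lift_definition uminus_ncser :: "'a ncser \<Rightarrow> 'a ncser" is "\<lambda>p w. - p w" .
lift_definition times_ncser :: "'a ncser \<Rightarrow> 'a ncser \<Rightarrow> 'a ncser" is fa_mult .

instance
proof
  show "(0::'a ncser) \<noteq> 1"
    by transfer (auto simp: fa_one_def fun_eq_iff)
qed (transfer; simp add: fa_add_def fa_minus_def fa_mult_assoc fa_mult_one_left fa_mult_one_right
      fa_mult_add_left fa_mult_add_right fun_eq_iff add.assoc add.commute)+

end

lift_definition scal :: "'r::comm_ring_1 \<Rightarrow> 'r ncser" is fa_scal .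
lift_definition gen :: "gen \<Rightarrow> 'r::comm_ring_1 ncser" is fa_gen .

lemma fa_mult_scal_left: "fa_mult (fa_scal a) p = fa_smul a p"
  using fa_mult_one_left[of p]
  by (simp add: fa_scal_def fa_smul_def fun_eq_iff fa_mult_smul_left)

lemma fa_mult_scal_right: "fa_mult p (fa_scal a) = fa_smul a p"
  using fa_mult_one_right[of p]
  by (simp add: fa_scal_def fa_smul_def fun_eq_iff fa_mult_smul_right)

lemma scal_commute: "x * scal a = scal a * x"
  by transfer (simp add: fa_mult_scal_left fa_mult_scal_right)

lemma scal_left_commute: "x * (scal a * y) = scal a * (x * y)"
  by (metis mult.assoc scal_commute)

lemma scal_add: "scal (a + b) = scal a + scal b"
  by transfer (auto simp: fa_scal_def fa_smul_def fa_add_def algebra_simps)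

lemma scal_diff: "scal (a - b) = scal a - scal b"
  by transfer (auto simp: fa_scal_def fa_smul_def fa_minus_def algebra_simps)

lemma scal_minus: "scal (- a) = - scal a"
  by transfer (auto simp: fa_scal_def fa_smul_def algebra_simps)

lemma scal_mult: "scal (a * b) = scal a * scal b"
  by transfer (auto simp: fa_mult_scal_left, auto simp: fa_scal_def fa_smul_def algebra_simps)

lemma scal_0 [simp]: "scal 0 = 0"
  by transfer (auto simp: fa_scal_def fa_smul_def)

lemma scal_1 [simp]: "scal 1 = 1"
  by transfer (auto simp: fa_scal_def fa_smul_def)

lemma ser_add: "ser (fa_add p q) = ser p + ser q"
  by (simp add: plus_ncser.abs_eq)

lemma ser_minus: "ser (fa_minus p q) = ser p - ser q"
  by (simp add: minus_ncser.abs_eq)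

lemma ser_mult: "ser (fa_mult p q) = ser p * ser q"
  by (simp add: times_ncser.abs_eq)

lemma ser_scal: "ser (fa_scal a) = scal a"
  by (simp add: scal.abs_eq)

lemma ser_smul: "ser (fa_smul a p) = scal a * ser p"
  by (simp add: fa_mult_scal_left[symmetric] ser_mult ser_scal)

lemma ser_gen: "ser (fa_gen g) = gen g"
  by (simp add: gen.abs_eq)

lemma ser_one: "ser fa_one = 1"
  by (simp add: one_ncser.abs_eq)

lemma ser_zero: "ser (\<lambda>_. 0) = 0"
  by (simp add: zero_ncser.abs_eq)

lemma ser_sum:
  assumes "finite A"
  shows "ser (fa_sum f A) = (\<Sum>i\<in>A. ser (f i))"
  using assms
proof (induction rule: finite_induct)
  case (insert i A)
  then have "fa_sum f (insert i A) = fa_add (f i) (fa_sum f A)"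
    by (simp add: fa_sum_def fa_add_def)
  with insert show ?case by (simp add: ser_add)
qed (simp add: fa_sum_def ser_zero)

lemma fa_prod_Nil [simp]: "fa_prod [] = fa_one"
  and fa_prod_Cons [simp]: "fa_prod (p # ps) = fa_mult p (fa_prod ps)"
  by (simp_all add: fa_prod_def)

lemma ser_prod: "ser (fa_prod ps) = prod_list (map ser ps)"
  by (induction ps) (simp_all add: ser_one ser_mult)

lemma ser_pow: "ser (fa_pow p k) = ser p ^ k"
  by (induction k) (simp_all add: fa_pow_def ser_one ser_mult)

lemma ser_poly: "ser (fa_poly p x) = (\<Sum>i\<le>degree p. scal (coeff p i) * ser x ^ i)"
  by (simp add: fa_poly_def ser_sum ser_smul ser_pow)

lemmas ser_simps = ser_add ser_minus ser_mult ser_scal ser_smul ser_gen ser_one ser_zero ser_prod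
  ser_pow ser_poly

section \<open>Membership in the free algebra\<close>

lemma fa_carrier_finite: "p \<in> fa_carrier n \<Longrightarrow> finite {w. p w \<noteq> 0}"
  by (simp add: fa_carrier_def)

lemma fa_carrier_supportI:
  assumes "\<And>w. s w \<noteq> 0 \<Longrightarrow> p w \<noteq> 0 \<or> q w \<noteq> 0" "p \<in> fa_carrier n" "q \<in> fa_carrier n"
  shows "s \<in> fa_carrier n"
proof -
  have "finite ({w. p w \<noteq> 0} \<union> {w. q w \<noteq> 0})"
    using assms by (simp add: fa_carrier_def)
  then have "finite {w. s w \<noteq> 0}"
    by (rule rev_finite_subset) (use assms in auto)
  with assms show ?thesis unfolding fa_carrier_def by blast
qed

lemma fa_carrier_add [simp]: "p \<in> fa_carrier n \<Longrightarrow> q \<in> fa_carrier n \<Longrightarrow> fa_add p q \<in> fa_carrier n"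
  by (rule fa_carrier_supportI[of _ p q]) (auto simp: fa_add_def)

lemma fa_carrier_minus [simp]: "p \<in> fa_carrier n \<Longrightarrow> q \<in> fa_carrier n \<Longrightarrow> fa_minus p q \<in> fa_carrier n"
  by (rule fa_carrier_supportI[of _ p q]) (auto simp: fa_minus_def)

lemma fa_carrier_smul [simp]: "p \<in> fa_carrier n \<Longrightarrow> fa_smul a p \<in> fa_carrier n"
  by (rule fa_carrier_supportI[of _ p p]) (auto simp: fa_smul_def)

lemma fa_carrier_one [simp]: "fa_one \<in> fa_carrier n"
  by (auto simp: fa_carrier_def fa_one_def)

lemma fa_carrier_zero [simp]: "(\<lambda>_. 0) \<in> fa_carrier n"
  by (auto simp: fa_carrier_def)

lemma fa_carrier_scal [simp]: "fa_scal a \<in> fa_carrier n"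
  by (simp add: fa_scal_def)

lemma fa_carrier_gen [simp]: "valid_gen n g \<Longrightarrow> fa_gen g \<in> fa_carrier n"
  by (auto simp: fa_carrier_def fa_gen_def)

lemma fa_mult_nonzero:
  assumes "fa_mult p q w \<noteq> 0"
  obtains x y where "w = x @ y" "p x \<noteq> 0" "q y \<noteq> 0"
proof -
  obtain k where "p (take k w) * q (drop k w) \<noteq> 0"
    using assms unfolding fa_mult_def by (metis (no_types, lifting) sum.neutral)
  then show ?thesis by (intro that[of "take k w" "drop k w"]) auto
qed

lemma fa_carrier_mult [simp]:
  assumes "p \<in> fa_carrier n" "q \<in> fa_carrier n"
  shows "fa_mult p q \<in> fa_carrier n"
proof -
  have "finite ((\<lambda>(x,y). x @ y) ` ({w. p w \<noteq> 0} \<times> {w. q w \<noteq> 0}))"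
    using assms by (simp add: fa_carrier_def)
  then have "finite {w. fa_mult p q w \<noteq> 0}"
    by (rule rev_finite_subset) (force elim: fa_mult_nonzero)
  moreover have "\<forall>g\<in>set w. valid_gen n g" if nz: "fa_mult p q w \<noteq> 0" for w
  proof -
    obtain x y where "w = x @ y" "p x \<noteq> 0" "q y \<noteq> 0"
      using nz by (rule fa_mult_nonzero)
    with assms show ?thesis by (auto simp: fa_carrier_def)
  qed
  ultimately show ?thesis by (simp add: fa_carrier_def)
qed

lemma fa_carrier_sum [simp]:
  assumes "\<And>i. i \<in> A \<Longrightarrow> f i \<in> fa_carrier n"
  shows "fa_sum f A \<in> fa_carrier n"
proof (cases "finite A")
  case True
  then show ?thesis using assms
  proof (induction rule: finite_induct)
    case (insert i A)
    then have "fa_sum f (insert i A) = fa_add (f i) (fa_sum f A)"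
      by (simp add: fa_sum_def fa_add_def)
    with insert show ?case by simp
  qed (simp add: fa_sum_def)
qed (simp add: fa_sum_def)

lemma fa_carrier_prod [simp]: "set ps \<subseteq> fa_carrier n \<Longrightarrow> fa_prod ps \<in> fa_carrier n"
  by (induction ps) simp_all

lemma fa_carrier_pow [simp]: "p \<in> fa_carrier n \<Longrightarrow> fa_pow p k \<in> fa_carrier n"
  by (auto simp: fa_pow_def intro!: fa_carrier_prod)

lemma fa_carrier_poly [simp]: "x \<in> fa_carrier n \<Longrightarrow> fa_poly p x \<in> fa_carrier n"
  by (simp add: fa_poly_def)

section \<open>Actions of the free algebra on functions\<close>

locale gen_action =
  fixes A :: "gen \<Rightarrow> ('s \<Rightarrow> 'r::comm_ring_1) \<Rightarrow> 's \<Rightarrow> 'r"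
  assumes A_add: "A g (\<lambda>s. f s + f' s) = (\<lambda>s. A g f s + A g f' s)"
    and A_smul: "A g (\<lambda>s. a * f s) = (\<lambda>s. a * A g f s)"
begin

text \<open>The leftmost letter of a word acts last, which makes this a left action. On infinite
  support the sum defaults to 0, so the laws for sums and products are stated on
  \<open>fa_carrier\<close>.\<close>

definition act :: "'r fa \<Rightarrow> ('s \<Rightarrow> 'r) \<Rightarrow> 's \<Rightarrow> 'r" where
  "act p f = (\<lambda>s. \<Sum>w | p w \<noteq> 0. p w * foldr A w f s)"

lemma A_zero: "A g (\<lambda>s. 0) = (\<lambda>s. 0)"
  using A_smul[of g 0 "\<lambda>s. 0"] by simp

lemma foldr_A_sum:
  assumes "finite B"
  shows "foldr A w (\<lambda>s. \<Sum>y\<in>B. c y * F y s) = (\<lambda>s. \<Sum>y\<in>B. c y * foldr A w (F y) s)"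
proof (induction w)
  case (Cons g w)
  have "A g (\<lambda>s. \<Sum>y\<in>B. c y * G y s) = (\<lambda>s. \<Sum>y\<in>B. c y * A g (G y) s)" for G
    using assms by (induction rule: finite_induct) (simp_all add: A_zero A_add A_smul)
  with Cons show ?case by simp
qed simp

lemma act_eq_sum:
  assumes "finite Z" "{w. p w \<noteq> 0} \<subseteq> Z"
  shows "act p f s = (\<Sum>w\<in>Z. p w * foldr A w f s)"
  unfolding act_def using assms by (intro sum.mono_neutral_left) auto

lemma act_mult:
  assumes p: "p \<in> fa_carrier n" and q: "q \<in> fa_carrier n"
  shows "act (fa_mult p q) f = act p (act q f)"
proof
  fix s
  let ?P = "{w. p w \<noteq> 0}" and ?Q = "{w. q w \<noteq> 0}"
  let ?S = "?P \<times> ?Q" and ?g = "\<lambda>(x,y). x @ y :: gen list"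
  have fin: "finite ?S" using p q by (simp add: fa_carrier_def)
  \<comment> \<open>A coefficient of the product sums over the cuts of \<open>w\<close>. A cut is
    the same as a pair of words that concatenate to \<open>w\<close>, and pairs outside the supports
    contribute 0.\<close>
  have split: "fa_mult p q w = (\<Sum>z\<in>{z \<in> ?S. ?g z = w}. p (fst z) * q (snd z))" for w
  proof -
    have splits: "(\<lambda>k. (take k w, drop k w)) ` {..length w} = {z. ?g z = w}"
    proof (intro equalityI subsetI)
      fix z assume "z \<in> {z. ?g z = w}"
      then show "z \<in> (\<lambda>k. (take k w, drop k w)) ` {..length w}"
        by (intro image_eqI[of _ _ "length (fst z)"]) (auto split: prod.splits)
    qed auto
    have "inj_on (\<lambda>k. (take k w, drop k w)) {..length w}"
      by (rule inj_onI) (auto dest!: arg_cong[where f = length])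
    then have "fa_mult p q w = (\<Sum>z\<in>(\<lambda>k. (take k w, drop k w)) ` {..length w}. p (fst z) * q (snd z))"
      by (simp add: fa_mult_def sum.reindex)
    also have "\<dots> = (\<Sum>z\<in>{z. ?g z = w}. p (fst z) * q (snd z))"
      unfolding splits ..
    also have "\<dots> = (\<Sum>z\<in>{z \<in> ?S. ?g z = w}. p (fst z) * q (snd z))"
    proof (rule sum.mono_neutral_right)
      show "finite {z. ?g z = w}" unfolding splits[symmetric] by simp
    qed auto
    finally show ?thesis .
  qed
  have "{w. fa_mult p q w \<noteq> 0} \<subseteq> ?g ` ?S"
    by (force elim: fa_mult_nonzero)
  then have "act (fa_mult p q) f s = (\<Sum>w\<in>?g ` ?S. fa_mult p q w * foldr A w f s)"
    using fin by (intro act_eq_sum) auto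
  also have "\<dots> = (\<Sum>w\<in>?g ` ?S. \<Sum>z\<in>{z \<in> ?S. ?g z = w}. p (fst z) * q (snd z) * foldr A (?g z) f s)"
    unfolding split sum_distrib_right by (intro sum.cong refl) auto
  also have "\<dots> = (\<Sum>z\<in>?S. p (fst z) * q (snd z) * foldr A (?g z) f s)"
    by (rule sum.image_gen[OF fin, symmetric])
  also have "\<dots> = (\<Sum>x\<in>?P. \<Sum>y\<in>?Q. p x * (q y * foldr A x (foldr A y f) s))"
    by (simp add: sum.cartesian_product split_def mult.assoc)
  also have "\<dots> = act p (act q f) s"
    using q by (simp add: act_def foldr_A_sum fa_carrier_def sum_distrib_left)
  finally show "act (fa_mult p q) f s = act p (act q f) s" .
qed

lemma act_add:
  assumes "p \<in> fa_carrier n" "q \<in> fa_carrier n"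
  shows "act (fa_add p q) f = (\<lambda>s. act p f s + act q f s)"
proof
  fix s
  let ?Z = "{w. p w \<noteq> 0} \<union> {w. q w \<noteq> 0}"
  have "finite ?Z" using assms by (simp add: fa_carrier_def)
  then show "act (fa_add p q) f s = act p f s + act q f s"
    by (subst (1 2 3) act_eq_sum[of ?Z]) (auto simp: fa_add_def algebra_simps sum.distrib)
qed

lemma act_smul:
  assumes "p \<in> fa_carrier n"
  shows "act (fa_smul a p) f = (\<lambda>s. a * act p f s)"
proof
  fix s
  show "act (fa_smul a p) f s = a * act p f s"
    using assms by (subst (1 2) act_eq_sum[of "{w. p w \<noteq> 0}"])
      (auto simp: fa_smul_def fa_carrier_def sum_distrib_left mult.assoc)
qed

lemma act_zero [simp]: "act (\<lambda>_. 0) f = (\<lambda>s. 0)"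
  by (simp add: act_def)

lemma act_minus:
  assumes "p \<in> fa_carrier n" "q \<in> fa_carrier n"
  shows "act (fa_minus p q) f = (\<lambda>s. act p f s - act q f s)"
proof -
  have "fa_minus p q = fa_add p (fa_smul (- 1) q)"
    by (auto simp: fa_minus_def fa_add_def fa_smul_def)
  with assms show ?thesis by (simp add: act_add[of _ n] act_smul[of _ n])
qed

lemma act_one [simp]: "act fa_one f = f"
proof
  fix s
  show "act fa_one f s = f s"
    by (subst act_eq_sum[of "{[]}"]) (auto simp: fa_one_def)
qed

lemma act_scal [simp]: "act (fa_scal a) f = (\<lambda>s. a * f s)"
  using act_smul[of fa_one 0] by (simp add: fa_scal_def)

lemma act_gen [simp]: "act (fa_gen g) f = A g f"
proof
  fix s
  show "act (fa_gen g) f s = A g f s"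
    by (subst act_eq_sum[of "{[g]}"]) (auto simp: fa_gen_def)
qed

lemma act_sum:
  assumes "\<And>i. i \<in> B \<Longrightarrow> F i \<in> fa_carrier n" "finite B"
  shows "act (fa_sum F B) f = (\<lambda>s. \<Sum>i\<in>B. act (F i) f s)"
  using assms(2,1)
proof (induction rule: finite_induct)
  case (insert i B)
  then have "fa_sum F (insert i B) = fa_add (F i) (fa_sum F B)"
    by (simp add: fa_sum_def fa_add_def)
  with insert show ?case by (simp add: act_add[of _ n])
qed (simp add: fa_sum_def)

lemma act_arg_zero: "act p (\<lambda>s. 0) = (\<lambda>s. 0)"
  \<comment> \<open>The zero function is an empty sum; \<open>nat\<close> is only a dummy index
    type.\<close>
  using foldr_A_sum[of "{} :: nat set"] by (simp add: act_def)

text \<open>Lets values on \<open>G\<close> be computed from values on \<open>G\<close> alone, as if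
  the module were restricted to functions on \<open>G\<close>.\<close>

lemma act_cong_on:
  assumes "\<And>g f f' s. valid_gen n g \<Longrightarrow> s \<in> G \<Longrightarrow> (\<And>s. s \<in> G \<Longrightarrow> f s = f' s) \<Longrightarrow> A g f s = A g f' s"
    and "p \<in> fa_carrier n" "s \<in> G" "\<And>s. s \<in> G \<Longrightarrow> f s = f' s"
  shows "act p f s = act p f' s"
proof -
  have "\<forall>s\<in>G. foldr A w f s = foldr A w f' s" if "\<forall>g\<in>set w. valid_gen n g" for w
    using that by (induction w) (auto simp: assms(4) intro!: assms(1))
  then show ?thesis
    unfolding act_def using assms(2,3) by (intro sum.cong) (auto simp: fa_carrier_def)
qed

text \<open>In a product \<open>a x b\<close> the inner part \<open>x b f\<close> vanishes only on
  \<open>G\<close>; stability under the generators is what lets \<open>a\<close> see it as the zero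
  function.\<close>

lemma act_ideal_zero:
  assumes stable: "\<And>g f f' s. valid_gen n g \<Longrightarrow> s \<in> G \<Longrightarrow> (\<And>s. s \<in> G \<Longrightarrow> f s = f' s) \<Longrightarrow> A g f s = A g f' s"
    and S: "S \<subseteq> fa_carrier n"
    and rel: "\<And>x f s. x \<in> S \<Longrightarrow> s \<in> G \<Longrightarrow> act x f s = 0"
    and x: "x \<in> fa_ideal n S"
  shows "x \<in> fa_carrier n \<and> (\<forall>f. \<forall>s\<in>G. act x f s = 0)"
  using x
proof (induction rule: fa_ideal.induct)
  case (gen x a b)
  then have x: "x \<in> fa_carrier n" using S by auto
  have "act (fa_mult (fa_mult a x) b) f s = 0" if "s \<in> G" for f s
  proof -
    have "act (fa_mult (fa_mult a x) b) f s = act a (act x (act b f)) s"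
      using gen x by (simp add: act_mult[of _ n])
    also have "\<dots> = act a (\<lambda>s. 0) s"
      using gen that rel by (intro act_cong_on[OF stable]) auto
    finally show ?thesis by (simp add: act_arg_zero)
  qed
  with gen x show ?case by simp
qed (simp_all add: act_add[of _ n])

end

section \<open>Words in the symmetric group\<close>

lemma perm_of_word_Nil [simp]: "perm_of_word [] = id"
  and perm_of_word_Cons [simp]: "perm_of_word (i # l) = transpose i (i + 1) \<circ> perm_of_word l"
  by (simp_all add: perm_of_word_def)

lemma perm_of_word_append: "perm_of_word (l @ l') = perm_of_word l \<circ> perm_of_word l'"
  by (induction l) (simp_all add: comp_assoc)

lemma transpose_Suc_permutes: "1 \<le> i \<Longrightarrow> i < n \<Longrightarrow> transpose i (Suc i) permutes {1..n}"
  by (rule permutes_swap_id) auto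

lemma perm_of_word_permutes: "set l \<subseteq> {1..<n} \<Longrightarrow> perm_of_word l permutes {1..n}"
  by (induction l) (auto intro!: permutes_compose transpose_Suc_permutes[simplified] simp: permutes_id)

text \<open>Passing to inverses turns a new first letter into composition on the right, an exchange
  of two adjacent positions, which is how the operators on states behave.\<close>

lemma inv_perm_of_word_Cons:
  "inv (perm_of_word (i # l)) = inv (perm_of_word l) \<circ> transpose i (i + 1)"
proof -
  have "bij (perm_of_word l)" by (induction l) (simp_all add: bij_comp del: id_apply o_apply)
  then show ?thesis by (simp add: o_inv_distrib)
qed

definition inversions :: "nat \<Rightarrow> (nat \<Rightarrow> nat) \<Rightarrow> (nat \<times> nat) set" where
  "inversions n m = {(i,j). 1 \<le> i \<and> i < j \<and> j \<le> n \<and> m j < m i}"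

lemma finite_inversions [simp]: "finite (inversions n m)"
  by (rule finite_subset[of _ "{1..n} \<times> {1..n}"]) (auto simp: inversions_def)

lemma inversions_id [simp]: "inversions n id = {}"
  by (auto simp: inversions_def)

text \<open>Applying the swap to both entries is a bijection from the old inversions to the new ones
  other than \<open>(i, Suc i)\<close>, since the swap preserves the order of every other
  pair.\<close>

lemma card_inversions_ascent:
  assumes "1 \<le> i" "i < n" "m i < m (Suc i)"
  shows "card (inversions n (m \<circ> transpose i (Suc i))) = Suc (card (inversions n m))"
proof -
  let ?s = "transpose i (Suc i)"
  have mono: "?s a < ?s b" if "a < b" "(a, b) \<noteq> (i, Suc i)" for a b
    using that by (auto simp: transpose_def)
  have range: "1 \<le> ?s a \<and> ?s a \<le> n" if "1 \<le> a" "a \<le> n" for a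
    using that assms by (auto simp: transpose_def)
  have "inversions n (m \<circ> ?s) = insert (i, Suc i) (map_prod ?s ?s ` inversions n m)"
  proof (intro equalityI subsetI)
    fix x assume "x \<in> insert (i, Suc i) (map_prod ?s ?s ` inversions n m)"
    then consider "x = (i, Suc i)" | a b where "x = (?s a, ?s b)" "(a, b) \<in> inversions n m" by auto
    then show "x \<in> inversions n (m \<circ> ?s)"
    proof cases
      case (2 a b)
      then have "(a, b) \<noteq> (i, Suc i)" using assms by (auto simp: inversions_def)
      with 2 mono range[of a] range[of b] show ?thesis by (simp add: inversions_def)
    qed (use assms in \<open>auto simp: inversions_def\<close>)
  next
    fix x assume x: "x \<in> inversions n (m \<circ> ?s)"
    obtain a b where ab: "x = (a, b)" by (cases x)
    show "x \<in> insert (i, Suc i) (map_prod ?s ?s ` inversions n m)"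
    proof (cases "(a, b) = (i, Suc i)")
      case False
      with x ab mono range[of a] range[of b] have "(?s a, ?s b) \<in> inversions n m"
        by (simp add: inversions_def)
      then have "map_prod ?s ?s (?s a, ?s b) \<in> map_prod ?s ?s ` inversions n m" by (rule imageI)
      with ab show ?thesis by simp
    qed (simp add: ab)
  qed
  moreover have "(i, Suc i) \<notin> map_prod ?s ?s ` inversions n m"
  proof
    assume "(i, Suc i) \<in> map_prod ?s ?s ` inversions n m"
    then obtain x where x: "(i, Suc i) = map_prod ?s ?s x" "x \<in> inversions n m"
      by (rule imageE)
    have "map_prod ?s ?s (i, Suc i) = x" unfolding x(1) by (cases x) simp
    then have "x = (Suc i, i)" by simp
    with x(2) show False by (simp add: inversions_def)
  qed
  moreover have "inj_on (map_prod ?s ?s) (inversions n m)"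
    by (rule inj_on_inverseI[of _ "map_prod ?s ?s"]) auto
  ultimately show ?thesis by (simp add: card_image)
qed

lemma comp_transpose_cancel [simp]: "m \<circ> transpose i j \<circ> transpose i j = m"
  by (simp add: fun_eq_iff)

lemma card_inversions_descent:
  assumes "1 \<le> i" "i < n" "m (Suc i) < m i"
  shows "card (inversions n m) = Suc (card (inversions n (m \<circ> transpose i (Suc i))))"
  using card_inversions_ascent[of i n "m \<circ> transpose i (Suc i)"] assms by simp

lemma card_inversions_transpose_le:
  assumes "1 \<le> i" "i < n" "inj m"
  shows "card (inversions n (m \<circ> transpose i (Suc i))) \<le> Suc (card (inversions n m))"
    and "card (inversions n m) \<le> Suc (card (inversions n (m \<circ> transpose i (Suc i))))"
proof -
  have "m i \<noteq> m (Suc i)" using assms(3) by (simp add: inj_eq)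
  then consider "m i < m (Suc i)" | "m (Suc i) < m i" by linarith
  then show "card (inversions n (m \<circ> transpose i (Suc i))) \<le> Suc (card (inversions n m))"
    and "card (inversions n m) \<le> Suc (card (inversions n (m \<circ> transpose i (Suc i))))"
    by (cases; use assms card_inversions_ascent[of i n m] card_inversions_descent[of i n m] in simp)+
qed

lemma inj_inv_perm_of_word: "set l \<subseteq> {1..<n} \<Longrightarrow> inj (inv (perm_of_word l))"
  by (meson perm_of_word_permutes permutes_inj permutes_inv)

lemma card_inversions_le_length:
  "set l \<subseteq> {1..<n} \<Longrightarrow> card (inversions n (inv (perm_of_word l))) \<le> length l"
proof (induction l)
  case (Cons i l)
  then have "card (inversions n (inv (perm_of_word l) \<circ> transpose i (Suc i)))
      \<le> Suc (card (inversions n (inv (perm_of_word l))))"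
    by (intro card_inversions_transpose_le inj_inv_perm_of_word) auto
  also have "\<dots> \<le> length (i # l)" using Cons by simp
  finally show ?case by (simp only: inv_perm_of_word_Cons Suc_eq_plus1)
qed simp

text \<open>Without descents an injective map increases strictly on \<open>{1..n}\<close>, so
  \<open>i \<le> m i\<close> by induction, and a permutation that never lowers a point is the
  identity.\<close>

lemma no_descents_imp_id:
  fixes m :: "nat \<Rightarrow> nat"
  assumes "m permutes {1..n}" "\<And>i. 1 \<le> i \<Longrightarrow> i < n \<Longrightarrow> m i \<le> m (Suc i)"
  shows "m = id"
proof (rule permutes_natset_ge[OF assms(1)], rule ballI)
  have "1 \<le> i \<Longrightarrow> i \<le> n \<Longrightarrow> i \<le> m i" for i
  proof (induction i)
    case (Suc i)
    show ?case
    proof (cases "i = 0")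
      case True
      with Suc.prems permutes_in_image[OF assms(1), of 1] show ?thesis by simp
    next
      case False
      have "m i \<noteq> m (Suc i)" using permutes_inj[OF assms(1)] by (simp add: inj_eq)
      with False Suc assms(2)[of i] show ?thesis by simp
    qed
  qed simp
  then show "i \<le> m i" if "i \<in> {1..n}" for i using that by simp
qed

text \<open>This is sorting: each descent of \<open>inv w\<close> yields a first letter whose
  removal lowers the inversion number by one.\<close>

lemma exists_word_length_inversions:
  assumes "w permutes {1..n}"
  shows "\<exists>l. set l \<subseteq> {1..<n} \<and> perm_of_word l = w \<and> length l = card (inversions n (inv w))"
  using assms
proof (induction "card (inversions n (inv w))" arbitrary: w rule: less_induct)
  case less
  note invp = permutes_inv[OF less.prems]
  show ?case
  proof (cases "\<exists>i. 1 \<le> i \<and> i < n \<and> inv w (Suc i) < inv w i")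
    case False
    then have "inv w i \<le> inv w (Suc i)" if "1 \<le> i" "i < n" for i
      using that not_less by blast
    then have "inv w = id" by (rule no_descents_imp_id[OF invp])
    then have "w = id" using less.prems by (metis inv_id permutes_inv_inv)
    then show ?thesis by (intro exI[of _ "[]"]) simp
  next
    case True
    then obtain i where i: "1 \<le> i" "i < n" "inv w (Suc i) < inv w i" by blast
    let ?s = "transpose i (Suc i)"
    have w': "?s \<circ> w permutes {1..n}"
      using less.prems transpose_Suc_permutes[OF i(1,2)] by (rule permutes_compose)
    have inv': "inv (?s \<circ> w) = inv w \<circ> ?s"
      using permutes_bij[OF less.prems] by (simp add: o_inv_distrib)
    have card': "card (inversions n (inv w)) = Suc (card (inversions n (inv (?s \<circ> w))))"
      unfolding inv' using i by (rule card_inversions_descent)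
    obtain l where l: "set l \<subseteq> {1..<n}" "perm_of_word l = ?s \<circ> w"
      "length l = card (inversions n (inv (?s \<circ> w)))"
      using less.hyps[OF _ w'] card' by auto
    have "perm_of_word (i # l) = w" using l by (simp add: o_assoc[symmetric] fun_eq_iff)
    with l i card' show ?thesis by (intro exI[of _ "i # l"]) simp
  qed
qed

text \<open>Minimality of the word picked by \<open>SOME\<close> becomes an equation for its length,
  a form of reducedness that can be passed on letter by letter.\<close>

lemma reduced_word_some:
  assumes "w permutes {1..n}"
  defines "l \<equiv> SOME l. reduced_word n l w"
  shows "set l \<subseteq> {1..<n}" "perm_of_word l = w" "length l = card (inversions n (inv w))"
proof -
  have set_eq: "{1..n-1} = {1..<n}" by auto
  obtain l0 where l0: "set l0 \<subseteq> {1..<n}" "perm_of_word l0 = w"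
    "length l0 = card (inversions n (inv w))"
    using exists_word_length_inversions[OF assms(1)] by blast
  then have "reduced_word n l0 w"
    unfolding reduced_word_def set_eq using card_inversions_le_length by metis
  then have "reduced_word n l w" unfolding l_def by (rule someI)
  then have l: "set l \<subseteq> {1..<n}" "perm_of_word l = w" "length l \<le> length l0"
    using l0 unfolding reduced_word_def set_eq by blast+
  then show "set l \<subseteq> {1..<n}" "perm_of_word l = w" by simp_all
  show "length l = card (inversions n (inv w))"
    using l l0 card_inversions_le_length[of l n] by simp
qed

text \<open>The length bound is attained for \<open>i # l\<close> and one letter adds at most one
  inversion. So the bound is attained for \<open>l\<close> too, and \<open>i\<close> did add an
  inversion, which happens only at an ascent.\<close>

lemma reduced_Cons_ascent:
  assumes l: "set (i # l) \<subseteq> {1..<n}"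
    and len: "card (inversions n (inv (perm_of_word (i # l)))) = length (i # l)"
  shows "inv (perm_of_word l) i < inv (perm_of_word l) (Suc i)"
    and "card (inversions n (inv (perm_of_word l))) = length l"
proof -
  let ?m = "inv (perm_of_word l)"
  have eq: "card (inversions n (?m \<circ> transpose i (Suc i))) = Suc (length l)"
    using len by (simp add: inv_perm_of_word_Cons del: perm_of_word_Cons)
  have le: "card (inversions n ?m) \<le> length l"
    using l by (intro card_inversions_le_length) auto
  have "inj ?m" by (rule inj_inv_perm_of_word[of _ n]) (use l in simp)
  then have "?m i \<noteq> ?m (Suc i)" by (simp add: inj_eq)
  moreover have "\<not> ?m (Suc i) < ?m i"
    using card_inversions_descent[of i n ?m] l eq le by auto
  ultimately show asc: "?m i < ?m (Suc i)" by simp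
  show "card (inversions n ?m) = length l"
    using card_inversions_ascent[OF _ _ asc, of n] l eq by auto
qed

text \<open>A permutation of \<open>{1..m+2}\<close> sending \<open>m + 2\<close> to \<open>j\<close> is the cycle
  \<open>s\<^sub>j s\<^sub>j\<^sub>+\<^sub>1 \<dots> s\<^sub>m\<^sub>+\<^sub>1\<close> times a permutation of \<open>{1..m+1}\<close>.\<close>

primrec normal_words :: "nat \<Rightarrow> nat list set" where
  "normal_words 0 = {[]}"
| "normal_words (Suc m) = (\<lambda>(j,l). [j..<Suc (Suc m)] @ l) ` ({1..Suc (Suc m)} \<times> normal_words m)"

lemma finite_normal_words [simp]: "finite (normal_words m)"
  by (induction m) simp_all

lemma set_normal_word: "l \<in> normal_words m \<Longrightarrow> set l \<subseteq> {1..m}"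
  by (induction m arbitrary: l) fastforce+

lemma perm_of_upt_last: "j \<le> k \<Longrightarrow> perm_of_word [j..<k] k = j"
  by (induction rule: inc_induct) (simp_all add: upt_conv_Cons)

text \<open>The tail \<open>l\<close> fixes \<open>Suc (Suc m)\<close>, so the cycle alone moves it.
  This recovers \<open>j\<close> from the permutation and makes the normal form unique.\<close>

lemma perm_of_normal_word_last:
  assumes "l \<in> normal_words m" "j \<le> Suc (Suc m)"
  shows "perm_of_word ([j..<Suc (Suc m)] @ l) (Suc (Suc m)) = j"
proof -
  have "perm_of_word l permutes {1..Suc m}"
    using set_normal_word[OF assms(1)] by (intro perm_of_word_permutes) auto
  then have "perm_of_word l (Suc (Suc m)) = Suc (Suc m)" by (rule permutes_not_in) simp
  with perm_of_upt_last[OF assms(2)] show ?thesis by (simp add: perm_of_word_append del: upt_Suc)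
qed

lemma inj_on_perm_of_normal_word: "inj_on perm_of_word (normal_words m)"
proof (induction m)
  case (Suc m)
  show ?case
  proof (rule inj_onI)
    fix x y
    assume x: "x \<in> normal_words (Suc m)" and y: "y \<in> normal_words (Suc m)"
      and eq: "perm_of_word x = perm_of_word y"
    obtain j l where jl: "x = [j..<Suc (Suc m)] @ l" "j \<in> {1..Suc (Suc m)}" "l \<in> normal_words m"
      using x by (auto simp del: upt_Suc)
    obtain k l' where kl: "y = [k..<Suc (Suc m)] @ l'" "k \<in> {1..Suc (Suc m)}" "l' \<in> normal_words m"
      using y by (auto simp del: upt_Suc)
    have "j = k"
      using perm_of_normal_word_last[of l m j] perm_of_normal_word_last[of l' m k] jl kl eq by auto
    moreover have "inj (perm_of_word [j..<Suc (Suc m)])"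
      using jl(2) by (intro permutes_inj[OF perm_of_word_permutes[of _ "Suc (Suc m)"]]) auto
    ultimately have "perm_of_word l = perm_of_word l'"
      using eq jl kl by (simp add: perm_of_word_append fun.inj_map_strong fun_eq_iff inj_eq del: upt_Suc)
    with Suc jl kl \<open>j = k\<close> show "x = y" by (auto dest: inj_onD)
  qed
qed simp

text \<open>The cycle is built from its right end. When \<open>i\<close> is prepended, the inverse
  already sends \<open>Suc i\<close> to the largest point \<open>Suc (Suc m)\<close>, so
  \<open>i\<close> is an ascent and the new letter costs exactly one inversion.\<close>

lemma card_inversions_normal_word:
  "l \<in> normal_words m \<Longrightarrow> m < n \<Longrightarrow> card (inversions n (inv (perm_of_word l))) = length l"
proof (induction m arbitrary: l)
  case (Suc m)
  obtain j l' where jl: "l = [j..<Suc (Suc m)] @ l'" "j \<in> {1..Suc (Suc m)}" "l' \<in> normal_words m"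
    using Suc.prems by (auto simp del: upt_Suc)
  let ?N = "Suc (Suc m)"
  have "j \<le> ?N \<Longrightarrow> 1 \<le> j \<Longrightarrow> card (inversions n (inv (perm_of_word ([j..<?N] @ l')))) = length ([j..<?N] @ l')"
  proof (induction j rule: inc_induct)
    case base
    then show ?case using Suc.IH[OF jl(3)] Suc.prems by simp
  next
    case (step i)
    let ?P = "perm_of_word ([Suc i..<?N] @ l')"
    have perm: "?P permutes {1..?N}"
      using set_normal_word[OF jl(3)] by (intro perm_of_word_permutes) auto
    have "?P ?N = Suc i"
      using jl(3) step by (intro perm_of_normal_word_last) auto
    then have last: "inv ?P (Suc i) = ?N" using permutes_inverses(2)[OF perm] by metis
    have "inv ?P i \<in> {1..?N}"
      using permutes_in_image[OF permutes_inv[OF perm], of i] step by auto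
    moreover have "inv ?P i \<noteq> ?N"
      using last permutes_inj[OF permutes_inv[OF perm]] by (metis injD n_not_Suc_n)
    ultimately have "inv ?P i < inv ?P (Suc i)" using last by auto
    then have card: "card (inversions n (inv ?P \<circ> transpose i (Suc i))) = Suc (card (inversions n (inv ?P)))"
      using step Suc.prems by (intro card_inversions_ascent) auto
    have step_inv: "inv (perm_of_word ([i..<?N] @ l')) = inv ?P \<circ> transpose i (Suc i)"
      using step inv_perm_of_word_Cons[of i "[Suc i..<?N] @ l'"] by (simp add: upt_conv_Cons del: upt_Suc perm_of_word_Cons)
    show ?case
      unfolding step_inv card using step by (simp del: upt_Suc)
  qed
  with jl show ?case by simp
qed simp

section \<open>The representation\<close>

lemma mult_rinv:
  fixes a :: "'r::idom"
  assumes "a dvd 1"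
  shows "a * rinv a = 1"
proof -
  obtain b where b: "a * b = 1" using assms by (metis dvdE)
  have "y = b" if "a * y = 1" for y
  proof -
    have "y = (a * b) * y" by (simp add: b)
    also have "\<dots> = (a * y) * b" by (simp only: ac_simps)
    finally show ?thesis by (simp add: that)
  qed
  with b have "rinv a = b" unfolding rinv_def by (rule the_equality)
  with b show ?thesis by simp
qed

text \<open>A state assigns to each position a letter (colour, label). On words of distinct letters the
  operators \<open>T\<^sub>i\<close> below are the usual \<open>R\<close>-matrices of type \<open>A\<close> for the order \<open>letter_less\<close>.\<close>

type_synonym state = "nat \<Rightarrow> nat \<times> nat"

text \<open>Labels are reversed at equal colours so that a labelling ascending at some place gives
  no correction there unless the colours rise. At different colours the labels are ignored.\<close>

definition letter_less :: "nat \<times> nat \<Rightarrow> nat \<times> nat \<Rightarrow> bool" where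
  "letter_less x y \<longleftrightarrow> fst x < fst y \<or> fst x = fst y \<and> snd y < snd x"

text \<open>If the letters ascend at \<open>s\<close>, then on the values at \<open>s\<close> and at
  the swapped state \<open>T_i\<close> has the matrix with rows \<open>(h, 1)\<close> and
  \<open>(1, 0)\<close>. For \<open>h = q - 1/q\<close> its characteristic polynomial
  \<open>X^2 - h X - 1\<close> is \<open>(X - q) (X + 1/q)\<close>.\<close>

fun state_op :: "'r::idom \<Rightarrow> (nat \<Rightarrow> 'r) \<Rightarrow> gen \<Rightarrow> (state \<Rightarrow> 'r) \<Rightarrow> state \<Rightarrow> 'r" where
  "state_op h u (Gt i) f s = u (fst (s i)) * f s"
| "state_op h u (GT i) f s = f (s \<circ> transpose i (Suc i))
     + (if letter_less (s i) (s (Suc i)) then h * f s else 0)"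

locale shoji =
  fixes n r :: nat and q :: "'r::idom" and u :: "nat \<Rightarrow> 'r"
  assumes n: "1 \<le> n" and r: "1 \<le> r" and q_unit: "q dvd 1" and Delta_unit: "Delta r u dvd 1"
begin

abbreviation h where "h \<equiv> q - rinv q"

lemma gen_action_state_op: "gen_action (state_op h u)"
proof
  show "state_op h u g (\<lambda>s. f s + f' s) = (\<lambda>s. state_op h u g f s + state_op h u g f' s)" for g f f'
    by (cases g) (auto simp: fun_eq_iff algebra_simps)
  show "state_op h u g (\<lambda>s. a * f s) = (\<lambda>s. a * state_op h u g f s)" for g a f
    by (cases g) (auto simp: fun_eq_iff algebra_simps)
qed

sublocale gen_action "state_op h u"
  by (rule gen_action_state_op)

lemma q_rinv [simp]: "q * rinv q = 1"
  using q_unit by (rule mult_rinv)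

lemma Delta_rinv: "Delta r u * rinv (Delta r u) = 1"
  using Delta_unit by (rule mult_rinv)

lemma diff_unit:
  assumes "i \<in> {1..r}" "j \<in> {1..r}" "i \<noteq> j"
  shows "(u i - u j) dvd 1"
proof -
  have *: "(u a - u b) dvd 1" if "b < a" "1 \<le> b" "a \<le> r" for a b
  proof -
    have fin: "finite {(i,j). 1 \<le> j \<and> j < i \<and> i \<le> r}"
      by (rule finite_subset[of _ "{1..r} \<times> {1..r}"]) auto
    have "(u a - u b) dvd Delta r u"
      unfolding Delta_def using dvd_prodI[OF fin, of "(a, b)" "\<lambda>(i,j). u i - u j"] that by simp
    with Delta_unit show ?thesis by (rule dvd_trans[rotated])
  qed
  from assms(3) consider "i < j" | "j < i" by linarith
  then show ?thesis
  proof cases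
    case 1
    then show ?thesis using *[of i j] assms by (metis atLeastAtMost_iff minus_diff_eq minus_dvd_iff)
  qed (use * assms in auto)
qed

lemma u_inj: "inj_on u {1..r}"
proof (rule inj_onI, rule ccontr)
  fix i j assume "i \<in> {1..r}" "j \<in> {1..r}" "u i = u j" "i \<noteq> j"
  with diff_unit[of i j] show False by simp
qed

section \<open>Lagrange interpolation at the parameters\<close>

definition lag :: "nat \<Rightarrow> 'r poly" where
  "lag c = (\<Prod>j\<in>{1..r}-{c}. smult (rinv (u c - u j)) [:- u j, 1:])"

lemma poly_lag:
  assumes "c \<in> {1..r}" "c' \<in> {1..r}"
  shows "poly (lag c) (u c') = (if c = c' then 1 else 0)"
proof (cases "c = c'")
  case True
  have "rinv (u c - u j) * (u c - u j) = 1" if "j \<in> {1..r} - {c}" for j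
    using mult_rinv[OF diff_unit, of c j] that assms by (simp add: mult.commute)
  then show ?thesis using True by (simp add: lag_def poly_prod algebra_simps)
qed (use assms in \<open>auto simp: lag_def poly_prod\<close>)

lemma degree_lag:
  assumes "c \<in> {1..r}"
  shows "degree (lag c) < r"
proof -
  have "degree (lag c) \<le> (\<Sum>j\<in>{1..r}-{c}. degree (smult (rinv (u c - u j)) [:- u j, 1:]))"
    unfolding lag_def by (rule degree_prod_sum_le[unfolded o_def]) simp
  also have "\<dots> \<le> (\<Sum>j\<in>{1..r}-{c}. 1)" by (intro sum_mono) auto
  also have "\<dots> < r" using assms r by simp
  finally show ?thesis .
qed

lemma poly_eq_interpolation:
  assumes "degree p < r" "degree p' < r" "\<And>c. c \<in> {1..r} \<Longrightarrow> poly p (u c) = poly p' (u c)"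
  shows "p = p'"
  using assms card_image[OF u_inj] by (intro poly_eqI_degree[of "u ` {1..r}"]) auto

text \<open>The definite description needs a witness, \<open>Delta r u\<close> times the Lagrange
  polynomial \<open>lag c\<close>, and uniqueness, which is interpolation at \<open>r\<close>
  distinct points.\<close>

lemma poly_Fpol:
  assumes "c \<in> {1..r}" "c' \<in> {1..r}"
  shows "poly (Fpol r u c) (u c') = (if c = c' then Delta r u else 0)"
proof -
  let ?P = "\<lambda>p. degree p \<le> r - 1 \<and> (\<forall>c'\<in>{1..r}. poly p (u c') = (if c = c' then Delta r u else 0))"
  have "?P (smult (Delta r u) (lag c))"
    using degree_lag[OF assms(1)] degree_smult_le[of "Delta r u" "lag c"] assms(1) by (auto simp: poly_lag)
  moreover have "p = p'" if "?P p" "?P p'" for p p'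
    using that r by (intro poly_eq_interpolation) auto
  ultimately have "?P (Fpol r u c)"
    unfolding Fpol_def by (intro theI2[where P = ?P and Q = ?P]) blast+
  with assms(2) show ?thesis by blast
qed

text \<open>The conventions outside \<open>{1..n}\<close> make a state the same as a colouring
  together with a permutation. Distinct labels make the letters at any two positions
  comparable.\<close>

definition states :: "state set" where
  "states = {s. (fst \<circ> s) \<in> {1..n} \<rightarrow>\<^sub>E {1..r} \<and> (snd \<circ> s) permutes {1..n}}"

lemma states_transpose:
  assumes "s \<in> states" "1 \<le> i" "i < n"
  shows "s \<circ> transpose i (Suc i) \<in> states"
proof -
  have p: "transpose i (Suc i) permutes {1..n}"
    using assms(2,3) by (rule transpose_Suc_permutes)
  have "fst \<circ> s \<circ> transpose i (Suc i) \<in> {1..n} \<rightarrow>\<^sub>E {1..r}"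
    using assms permutes_in_image[OF p] permutes_not_in[OF p]
    by (auto simp: states_def PiE_iff extensional_def)
  moreover have "snd \<circ> s \<circ> transpose i (Suc i) permutes {1..n}"
    using p assms by (intro permutes_compose) (auto simp: states_def)
  ultimately show ?thesis by (simp add: states_def comp_assoc)
qed

lemma states_colour: "s \<in> states \<Longrightarrow> 1 \<le> i \<Longrightarrow> i \<le> n \<Longrightarrow> fst (s i) \<in> {1..r}"
  by (auto simp: states_def PiE_iff)

lemma states_label_neq: "s \<in> states \<Longrightarrow> i \<noteq> j \<Longrightarrow> snd (s i) \<noteq> snd (s j)"
  unfolding states_def by (auto dest!: permutes_inj simp: inj_def)

lemma letter_less_swap:
  "s \<in> states \<Longrightarrow> i \<noteq> j \<Longrightarrow> letter_less (s j) (s i) \<longleftrightarrow> \<not> letter_less (s i) (s j)"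
  using states_label_neq[of s i j] by (auto simp: letter_less_def)

lemma letter_less_trans: "letter_less x y \<Longrightarrow> letter_less y z \<Longrightarrow> letter_less x z"
  by (auto simp: letter_less_def)

lemma gen_carrier [simp]:
  "1 \<le> i \<Longrightarrow> i \<le> n \<Longrightarrow> tg i \<in> fa_carrier n"
  "1 \<le> i \<Longrightarrow> i < n \<Longrightarrow> Tg i \<in> fa_carrier n"
  by (auto simp: valid_gen_def)

lemmas act_simps = act_mult[where n = n] act_add[where n = n] act_minus[where n = n]
  act_smul[where n = n]

text \<open>Carrier membership is bundled in so that one chain of introduction rules computes the
  eigenvalue of any polynomial expression in the \<open>t_i\<close>.\<close>

definition diag :: "'r fa \<Rightarrow> (state \<Rightarrow> 'r) \<Rightarrow> bool" where
  "diag p d \<longleftrightarrow> p \<in> fa_carrier n \<and> (\<forall>f. act p f = (\<lambda>s. d s * f s))"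

lemma diagD: "diag p d \<Longrightarrow> act p f s = d s * f s"
  and diag_carrier: "diag p d \<Longrightarrow> p \<in> fa_carrier n"
  by (simp_all add: diag_def)

lemma diag_tg: "1 \<le> i \<Longrightarrow> i \<le> n \<Longrightarrow> diag (tg i) (\<lambda>s. u (fst (s i)))"
  by (simp add: diag_def fun_eq_iff)

lemma diag_scal: "diag (fa_scal a) (\<lambda>s. a)"
  by (simp add: diag_def)

lemma diag_one: "diag fa_one (\<lambda>s. 1)"
  by (simp add: diag_def)

lemma diag_minus: "diag p d \<Longrightarrow> diag p' d' \<Longrightarrow> diag (fa_minus p p') (\<lambda>s. d s - d' s)"
  by (simp add: diag_def act_simps algebra_simps)

lemma diag_smul: "diag p d \<Longrightarrow> diag (fa_smul a p) (\<lambda>s. a * d s)"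
  by (simp add: diag_def act_simps algebra_simps)

lemma diag_mult: "diag p d \<Longrightarrow> diag p' d' \<Longrightarrow> diag (fa_mult p p') (\<lambda>s. d s * d' s)"
  by (simp add: diag_def act_simps algebra_simps)

lemma diag_sum:
  assumes "finite B" "\<And>i. i \<in> B \<Longrightarrow> diag (F i) (d i)"
  shows "diag (fa_sum F B) (\<lambda>s. \<Sum>i\<in>B. d i s)"
  using assms act_sum[of B F n] by (simp add: diag_def sum_distrib_right)

lemma diag_prod:
  assumes "\<And>x. x \<in> set xs \<Longrightarrow> diag (p x) (d x)"
  shows "diag (fa_prod (map p xs)) (\<lambda>s. \<Prod>x\<leftarrow>xs. d x s)"
  using assms by (induction xs) (simp_all add: diag_one diag_mult)

lemma diag_pow: "diag p d \<Longrightarrow> diag (fa_pow p k) (\<lambda>s. d s ^ k)"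
  by (induction k) (simp_all add: fa_pow_def diag_one diag_mult)

lemma diag_poly: "diag p d \<Longrightarrow> diag (fa_poly P p) (\<lambda>s. poly P (d s))"
  unfolding fa_poly_def poly_altdef by (intro diag_sum diag_smul diag_pow) simp_all

lemma fa_prod_append: "fa_prod (ps @ ps') = fa_mult (fa_prod ps) (fa_prod ps')"
  by (induction ps) (simp_all add: fa_mult_one_left fa_mult_assoc)

lemma diag_prod_concat:
  assumes "\<And>x. x \<in> set xs \<Longrightarrow> diag (fa_prod (p x)) (d x)"
  shows "diag (fa_prod (concat (map p xs))) (\<lambda>s. \<Prod>x\<leftarrow>xs. d x s)"
  using assms by (induction xs) (simp_all add: diag_one diag_mult fa_prod_append)

text \<open>At colours \<open>a\<close> and \<open>b\<close> only the summand \<open>(a, b)\<close>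
  survives, and its two factors \<open>Delta\<close> cancel against the prefactor. This evaluation
  needs colours in \<open>{1..r}\<close>, so the closed form of \<open>d\<close> is claimed on
  \<open>states\<close> only.\<close>

lemma diag_corr:
  assumes "2 \<le> j" "j \<le> n"
  shows "\<exists>d. diag (corr r q u j) d \<and> (\<forall>s\<in>states. d s =
    (if fst (s (j - 1)) < fst (s j) then (u (fst (s j)) - u (fst (s (j - 1)))) * h else 0))"
proof -
  let ?I = "{(c1,c2). 1 \<le> c1 \<and> c1 < c2 \<and> c2 \<le> r}"
  let ?co = "\<lambda>c1 c2. rinv (Delta r u) ^ 2 * (u c2 - u c1) * h"
  let ?d = "\<lambda>s. \<Sum>(c1,c2)\<in>?I. ?co c1 c2
      * (poly (Fpol r u c1) (u (fst (s (j - 1)))) * poly (Fpol r u c2) (u (fst (s j))))"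
  have fin: "finite ?I" by (rule finite_subset[of _ "{1..r} \<times> {1..r}"]) auto
  have "diag (corr r q u j) (\<lambda>s. \<Sum>c\<in>?I. (\<lambda>(c1,c2) s. ?co c1 c2
      * (poly (Fpol r u c1) (u (fst (s (j - 1)))) * poly (Fpol r u c2) (u (fst (s j))))) c s)"
    unfolding corr_def using assms fin
    by (intro diag_sum) (auto intro!: diag_smul diag_mult diag_poly diag_tg)
  then have "diag (corr r q u j) ?d" by (simp add: case_prod_unfold)
  moreover have "?d s = (if fst (s (j - 1)) < fst (s j) then (u (fst (s j)) - u (fst (s (j - 1)))) * h else 0)"
    if s: "s \<in> states" for s
  proof -
    define a b where "a = fst (s (j - 1))" and "b = fst (s j)"
    have ab: "a \<in> {1..r}" "b \<in> {1..r}"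
      unfolding a_def b_def using assms by (intro states_colour[OF s]; simp)+
    have D: "rinv (Delta r u) ^ 2 * (Delta r u * Delta r u) = 1"
    proof -
      have "rinv (Delta r u) ^ 2 * (Delta r u * Delta r u)
          = (Delta r u * rinv (Delta r u)) * (Delta r u * rinv (Delta r u))"
        by (simp only: power2_eq_square ac_simps)
      then show ?thesis by (simp add: Delta_rinv)
    qed
    have "?d s = (\<Sum>c\<in>?I. if (a, b) = c then (u b - u a) * h else 0)"
    proof (rule sum.cong[OF refl], clarify)
      fix c1 c2 assume c: "1 \<le> c1" "c1 < c2" "c2 \<le> r"
      have "?co c1 c2 * (Delta r u * Delta r u)
          = (rinv (Delta r u) ^ 2 * (Delta r u * Delta r u)) * ((u c2 - u c1) * h)"
        by (simp only: ac_simps)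
      then have "?co c1 c2 * (Delta r u * Delta r u) = (u c2 - u c1) * h"
        by (simp add: D)
      then show "?co c1 c2 * (poly (Fpol r u c1) (u (fst (s (j - 1)))) * poly (Fpol r u c2) (u (fst (s j))))
          = (if (a, b) = (c1, c2) then (u b - u a) * h else 0)"
        unfolding a_def[symmetric] b_def[symmetric] using ab c by (auto simp: poly_Fpol)
    qed
    also have "\<dots> = (if (a, b) \<in> ?I then (u b - u a) * h else 0)"
      by (subst sum.delta'[OF fin]) (rule refl)
    finally show ?thesis using ab by (simp add: a_def b_def)
  qed
  ultimately show ?thesis by blast
qed

lemma state_op_cong:
  assumes "valid_gen n g" "s \<in> states" "\<And>s. s \<in> states \<Longrightarrow> f s = f' s"
  shows "state_op h u g f s = state_op h u g f' s"
  using assms states_transpose[of s] by (cases g) (auto simp: valid_gen_def)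

lemma comp_transpose_braid:
  fixes s :: "nat \<Rightarrow> 'a"
  shows "s \<circ> transpose i (Suc i) \<circ> transpose (Suc i) (Suc (Suc i)) \<circ> transpose i (Suc i)
    = s \<circ> transpose (Suc i) (Suc (Suc i)) \<circ> transpose i (Suc i) \<circ> transpose (Suc i) (Suc (Suc i))"
  by (auto simp: fun_eq_iff transpose_def)

text \<open>Totality and transitivity exclude the two cyclic patterns among the eight outcomes of
  comparing three letters; in the other six both sides expand to the same combination of values of
  \<open>f\<close>.\<close>

lemma braid_state_op:
  assumes s: "s \<in> states"
  shows "state_op h u (GT i) (state_op h u (GT (Suc i)) (state_op h u (GT i) f)) s
    = state_op h u (GT (Suc i)) (state_op h u (GT i) (state_op h u (GT (Suc i)) f)) s"
proof -
  note sw = letter_less_swap[OF s]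
  have "letter_less (s (Suc i)) (s i) \<longleftrightarrow> \<not> letter_less (s i) (s (Suc i))"
    "letter_less (s (Suc (Suc i))) (s i) \<longleftrightarrow> \<not> letter_less (s i) (s (Suc (Suc i)))"
    "letter_less (s (Suc (Suc i))) (s (Suc i)) \<longleftrightarrow> \<not> letter_less (s (Suc i)) (s (Suc (Suc i)))"
    by (rule sw; simp)+
  moreover have "letter_less (s i) (s (Suc i)) \<Longrightarrow> letter_less (s (Suc i)) (s (Suc (Suc i)))
      \<Longrightarrow> letter_less (s i) (s (Suc (Suc i)))"
    by (rule letter_less_trans)
  moreover have "letter_less (s i) (s (Suc (Suc i))) \<Longrightarrow>
      letter_less (s i) (s (Suc i)) \<or> letter_less (s (Suc i)) (s (Suc (Suc i)))"
    using letter_less_trans[of "s (Suc (Suc i))" "s (Suc i)" "s i"] calculation by blast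
  ultimately show ?thesis
    by (cases "letter_less (s i) (s (Suc i))"; cases "letter_less (s (Suc i)) (s (Suc (Suc i)))";
        cases "letter_less (s i) (s (Suc (Suc i)))")
      (simp_all add: comp_transpose_braid algebra_simps)
qed

lemma act_hrel:
  assumes x: "x \<in> hrel n r q u" and s: "s \<in> states"
  shows "x \<in> fa_carrier n" and "act x f s = 0"
proof -
  have "x \<in> fa_carrier n \<and> act x f s = 0"
    using x unfolding hrel_def
  proof (elim UnE CollectE exE conjE)
    fix i assume x: "x = fa_mult (fa_minus (Tg i) (fa_scal q)) (fa_add (Tg i) (fa_scal (rinv q)))"
      and "1 \<le> i" "i \<le> n - 1"
    then have i: "1 \<le> i" "i < n" using n by auto
    have "rinv q * q = 1" using q_rinv by (simp add: mult.commute)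
    moreover have "letter_less (s (Suc i)) (s i) \<longleftrightarrow> \<not> letter_less (s i) (s (Suc i))"
      by (rule letter_less_swap[OF s]) simp
    ultimately show ?thesis unfolding x using i
      by (simp add: act_simps algebra_simps)
  next
    fix i assume x: "x = fa_prod (map (\<lambda>c. fa_minus (tg i) (fa_scal (u c))) [1..<r + 1])"
      and i: "1 \<le> i" "i \<le> n"
    have d: "diag x (\<lambda>s. \<Prod>c\<leftarrow>[1..<r + 1]. u (fst (s i)) - u c)"
      unfolding x using i by (intro diag_prod diag_minus diag_scal diag_tg) auto
    have "fst (s i) \<in> {1..r}" using s i by (rule states_colour)
    then have "(\<Prod>c\<leftarrow>[1..<r + 1]. u (fst (s i)) - u c) = 0"
      by (auto simp: prod_list_zero_iff simp del: upt_Suc)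
    with d show ?thesis by (simp add: diagD diag_carrier del: upt_Suc)
  next
    fix i assume x: "x = fa_minus (fa_prod [Tg i, Tg (i+1), Tg i]) (fa_prod [Tg (i+1), Tg i, Tg (i+1)])"
      and "1 \<le> i" "i + 1 \<le> n - 1"
    then have i: "1 \<le> i" "i < n" "Suc i < n" by auto
    then show ?thesis unfolding x
      using braid_state_op[OF s, of i f] by (simp add: act_simps fa_mult_one_right del: state_op.simps)
  next
    fix i j assume x: "x = fa_minus (fa_mult (Tg i) (Tg j)) (fa_mult (Tg j) (Tg i))"
      and "1 \<le> i" "i \<le> n - 1" "1 \<le> j" "j \<le> n - 1" and ij: "i + 2 \<le> j \<or> j + 2 \<le> i"
    then have i: "1 \<le> i" "i < n" "1 \<le> j" "j < n" by auto
    have eq: "s \<circ> transpose i (Suc i) \<circ> transpose j (Suc j) = s \<circ> transpose j (Suc j) \<circ> transpose i (Suc i)"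
      using ij by (auto simp: fun_eq_iff transpose_def)
    show ?thesis unfolding x using i ij
      by (auto simp add: act_simps eq algebra_simps)
  next
    fix i j assume "x = fa_minus (fa_mult (tg i) (tg j)) (fa_mult (tg j) (tg i))"
      and "1 \<le> i" "i \<le> n" "1 \<le> j" "j \<le> n"
    then show ?thesis by (simp add: act_simps)
  next
    fix j k assume "x = fa_minus (fa_mult (Tg j) (tg k)) (fa_mult (tg k) (Tg j))"
      and "1 \<le> j" "j \<le> n - 1" "1 \<le> k" "k \<le> n" "k \<noteq> j" "k \<noteq> j + 1"
    then show ?thesis by (auto simp: act_simps algebra_simps)
  next
    fix j assume x: "x = fa_minus (fa_minus (fa_mult (Tg (j-1)) (tg j)) (fa_mult (tg (j-1)) (Tg (j-1)))) (corr r q u j)"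
      and j: "2 \<le> j" "j \<le> n"
    obtain i where i: "j = Suc i" "1 \<le> i" "i < n" using j by (cases j) auto
    obtain d where d: "diag (corr r q u j) d" "d s = (if fst (s (j - 1)) < fst (s j)
        then (u (fst (s j)) - u (fst (s (j - 1)))) * h else 0)"
      using diag_corr[OF j] s by blast
    have "act (corr r q u (Suc i)) f s = (if fst (s i) < fst (s (Suc i))
        then (u (fst (s (Suc i))) - u (fst (s i))) * h else 0) * f s"
      using diagD[OF d(1), of f s] d(2) i by simp
    note corr = this diag_carrier[OF d(1), unfolded i]
    \<comment> \<open>Both products have the same swapped term. What is left, for ascending letters,
      is \<open>h\<close> times a difference of two parameters \<open>u\<close>. It is 0 at equal
      colours, so the tie-break by labels is invisible here and only rising colours have to match
      \<open>corr\<close>.\<close>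
    show ?thesis unfolding x using i
      by (auto simp: act_simps corr letter_less_def algebra_simps)
  next
    fix j assume x: "x = fa_add (fa_minus (fa_mult (Tg (j-1)) (tg (j-1))) (fa_mult (tg j) (Tg (j-1)))) (corr r q u j)"
      and j: "2 \<le> j" "j \<le> n"
    obtain i where i: "j = Suc i" "1 \<le> i" "i < n" using j by (cases j) auto
    obtain d where d: "diag (corr r q u j) d" "d s = (if fst (s (j - 1)) < fst (s j)
        then (u (fst (s j)) - u (fst (s (j - 1)))) * h else 0)"
      using diag_corr[OF j] s by blast
    have "act (corr r q u (Suc i)) f s = (if fst (s i) < fst (s (Suc i))
        then (u (fst (s (Suc i))) - u (fst (s i))) * h else 0) * f s"
      using diagD[OF d(1), of f s] d(2) i by simp
    note corr = this diag_carrier[OF d(1), unfolded i]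
    show ?thesis unfolding x using i
      by (auto simp: act_simps corr letter_less_def algebra_simps)
  qed
  then show "x \<in> fa_carrier n" "act x f s = 0" by auto
qed

end

section \<open>Images of a generating vector\<close>

context shoji
begin

text \<open>\<open>act_hrel\<close> gives carrier membership only in the presence of a state; this
  one, with all colours 1, provides it for every relation.\<close>

lemma states_nonempty: "states \<noteq> {}"
proof -
  have "(\<lambda>i. (if i \<in> {1..n} then 1 else undefined, i)) \<in> states"
    using r permutes_id[of "{1..n}"] by (auto simp: states_def comp_def id_def)
  then show ?thesis by blast
qed

lemma hrel_carrier: "hrel n r q u \<subseteq> fa_carrier n"
  using states_nonempty act_hrel(1) by blast

lemma H_ideal_act:
  assumes "x \<in> H_ideal n r q u"
  shows "x \<in> fa_carrier n" and "s \<in> states \<Longrightarrow> act x f s = 0"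
proof -
  have "x \<in> fa_carrier n \<and> (\<forall>f. \<forall>s\<in>states. act x f s = 0)"
    by (rule act_ideal_zero[OF state_op_cong _ _ assms[unfolded H_ideal_def]])
      (simp_all add: hrel_carrier act_hrel(2))
  then show "x \<in> fa_carrier n" and "s \<in> states \<Longrightarrow> act x f s = 0" by auto
qed

lemma prod_list_indicator:
  "(\<Prod>x\<leftarrow>xs. if P x then 1 else 0) = (if \<forall>x\<in>set xs. P x then 1 else 0 :: 'r)"
  by (induction xs) auto

lemma set_upt_Suc: "set [1..<m + 1] = {1..m}"
  by auto

text \<open>The factors at position \<open>i\<close> form the Lagrange polynomial of the colour
  \<open>k i\<close> evaluated at \<open>t_i\<close>, so \<open>b_k\<close> projects onto the words
  coloured by \<open>k\<close>.\<close>

lemma diag_bk: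
  assumes k: "k \<in> {1..n} \<rightarrow>\<^sub>E {1..r}"
  shows "\<exists>d. diag (bk n r u k) d \<and> (\<forall>s\<in>states. d s = (if fst \<circ> s = k then 1 else 0))"
proof -
  let ?js = "\<lambda>i. filter (\<lambda>j. j \<noteq> k i) [1..<r+1]"
  let ?e = "\<lambda>i s. \<Prod>j\<leftarrow>?js i. rinv (u (k i) - u j) * (u (fst (s i)) - u j)"
  have "diag (bk n r u k) (\<lambda>s. \<Prod>i\<leftarrow>[1..<n+1]. ?e i s)"
    unfolding bk_def
    by (intro diag_prod_concat diag_prod diag_smul diag_minus diag_scal diag_tg) auto
  moreover have "(\<Prod>i\<leftarrow>[1..<n+1]. ?e i s) = (if fst \<circ> s = k then 1 else 0)" if s: "s \<in> states" for s
  proof -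
    have e: "?e i s = (if fst (s i) = k i then 1 else 0)" if "i \<in> set [1..<n+1]" for i
    proof -
      have si: "fst (s i) \<in> {1..r}" and ki: "k i \<in> {1..r}"
        using states_colour[OF s, of i] k that by (auto simp: PiE_iff)
      show ?thesis
      proof (cases "fst (s i) = k i")
        case True
        have "rinv (u (k i) - u j) * (u (k i) - u j) = 1" if "j \<in> set (?js i)" for j
          using that mult_rinv[OF diff_unit, of "k i" j] ki by (auto simp: mult.commute)
        then have "?e i s = (\<Prod>j\<leftarrow>?js i. 1)"
          unfolding True by (intro arg_cong[where f = prod_list] map_cong refl)
        also have "\<dots> = 1" using prod_list_indicator[of "\<lambda>_. True" "?js i"]
          by (simp del: upt_Suc One_nat_def)
        finally show ?thesis using True by simp
      next
        case False
        then have "fst (s i) \<in> set (?js i)" using si by auto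
        then have "0 \<in> (\<lambda>j. rinv (u (k i) - u j) * (u (fst (s i)) - u j)) ` set (?js i)"
          by (intro image_eqI[of _ _ "fst (s i)"]) (simp_all del: upt_Suc)
        with False show ?thesis by (simp only: prod_list_zero_iff set_map if_False simp_thms)
      qed
    qed
    have "(\<Prod>i\<leftarrow>[1..<n+1]. ?e i s) = (\<Prod>i\<leftarrow>[1..<n+1]. if fst (s i) = k i then 1 else 0)"
      by (intro arg_cong[where f = prod_list] map_cong refl e)
    also have "\<dots> = (if \<forall>i\<in>{1..n}. fst (s i) = k i then 1 else 0)"
      unfolding prod_list_indicator set_upt_Suc ..
    also have "(\<forall>i\<in>{1..n}. fst (s i) = k i) \<longleftrightarrow> fst \<circ> s = k"
      using s k by (auto simp: states_def intro: PiE_ext)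
    finally show ?thesis .
  qed
  ultimately show ?thesis by blast
qed

lemma finite_colourings [simp]: "finite ({1..n} \<rightarrow>\<^sub>E {1..r})"
  by (intro finite_PiE) auto

text \<open>On a given state a single projection \<open>b_k\<close> of the sum can contribute, the
  one for the colouring of that state, and it occurs in the sum exactly when the colours rise from
  \<open>i\<close> to \<open>j\<close>.\<close>

lemma Bp_act:
  assumes "1 \<le> i" "i \<le> n" "1 \<le> j" "j \<le> n"
  shows "Bp n r q u i j \<in> fa_carrier n"
    and "s \<in> states \<Longrightarrow> act (Bp n r q u i j) f s = (if fst (s i) < fst (s j) then - h * f s else 0)"
proof -
  let ?I = "{k \<in> {1..n} \<rightarrow>\<^sub>E {1..r}. k i < k j}"
  have fin: "finite ?I" using finite_colourings by (rule rev_finite_subset) auto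
  obtain d where d: "diag (bk n r u k) (d k)" "\<forall>s\<in>states. d k s = (if fst \<circ> s = k then 1 else 0)"
    if "k \<in> ?I" for k
    using diag_bk by (metis (no_types, lifting) mem_Collect_eq)
  have B: "diag (Bp n r q u i j) (\<lambda>s. - h * (\<Sum>k\<in>?I. d k s))"
    unfolding Bp_def using d fin by (intro diag_smul diag_sum) auto
  then show "Bp n r q u i j \<in> fa_carrier n" by (rule diag_carrier)
  assume s: "s \<in> states"
  have "(\<Sum>k\<in>?I. d k s) = (\<Sum>k\<in>?I. if fst \<circ> s = k then 1 else 0)"
    using d s by (intro sum.cong) auto
  also have "\<dots> = (if fst \<circ> s \<in> ?I then 1 else 0)"
    by (rule sum.delta'[OF fin])
  also have "fst \<circ> s \<in> ?I \<longleftrightarrow> fst (s i) < fst (s j)"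
    using s by (auto simp: states_def)
  finally show "act (Bp n r q u i j) f s = (if fst (s i) < fst (s j) then - h * f s else 0)"
    using diagD[OF B, of f s] by simp
qed

lemma gg_carrier [simp]: "1 \<le> i \<Longrightarrow> i < n \<Longrightarrow> gg n r q u i \<in> fa_carrier n"
  unfolding gg_def using Bp_act(1)[of i "i + 1"] by simp

lemma act_gg:
  assumes "1 \<le> i" "i < n" "s \<in> states"
  shows "act (gg n r q u i) f s = f (s \<circ> transpose i (Suc i))
    + (if fst (s i) = fst (s (Suc i)) \<and> snd (s (Suc i)) < snd (s i) then h * f s else 0)"
  using assms Bp_act[of i "i + 1"]
  by (auto simp: gg_def act_simps letter_less_def algebra_simps)

definition v0 :: "state \<Rightarrow> 'r" where
  "v0 s = (if snd \<circ> s = id then 1 else 0)"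

lemma comp_transpose_eq_iff: "m \<circ> transpose i j = m' \<longleftrightarrow> m = m' \<circ> transpose i j"
  by (metis comp_transpose_cancel)

lemma act_g_word:
  assumes "set l \<subseteq> {1..<n}" "card (inversions n (inv (perm_of_word l))) = length l" "s \<in> states"
  shows "act (fa_prod (map (gg n r q u) l)) v0 s = (if snd \<circ> s = inv (perm_of_word l) then 1 else 0)"
  using assms
proof (induction l arbitrary: s)
  case (Cons i l)
  let ?F = "act (fa_prod (map (gg n r q u) l)) v0" and ?m = "inv (perm_of_word l)"
  note red = reduced_Cons_ascent[OF Cons.prems(1,2)]
  have i: "1 \<le> i" "i < n" and l: "set l \<subseteq> {1..<n}" using Cons.prems by auto
  have IH: "?F s' = (if snd \<circ> s' = ?m then 1 else 0)" if "s' \<in> states" for s'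
    using Cons.IH[OF l red(2) that] .
  have "set (map (gg n r q u) l) \<subseteq> fa_carrier n" using l by auto
  then have "act (fa_prod (map (gg n r q u) (i # l))) v0 s = act (gg n r q u i) ?F s"
    using i by (simp add: act_simps)
  also have "\<dots> = ?F (s \<circ> transpose i (Suc i))"
  proof -
    \<comment> \<open>\<open>?F\<close> lives on the labelling \<open>?m\<close>, and reducedness
      makes \<open>i\<close> an ascent of \<open>?m\<close>; the correction asks for a
      descent.\<close>
    have "\<not> snd (s (Suc i)) < snd (s i)" if "snd \<circ> s = ?m"
      using red(1) unfolding that[symmetric] by simp
    then show ?thesis using i Cons.prems(3) by (auto simp: act_gg IH)
  qed
  also have "\<dots> = (if snd \<circ> s \<circ> transpose i (Suc i) = ?m then 1 else 0)"
    by (simp add: IH states_transpose[OF Cons.prems(3) i] comp_assoc)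
  also have "snd \<circ> s \<circ> transpose i (Suc i) = ?m \<longleftrightarrow> snd \<circ> s = inv (perm_of_word (i # l))"
    unfolding comp_transpose_eq_iff inv_perm_of_word_Cons by simp
  finally show ?case .
qed (simp add: v0_def)

text \<open>A correction term skips a letter and keeps the labels, so it reaches only labellings
  with fewer than \<open>length l\<close> inversions. The bound on \<open>s\<close> hides all of
  these and leaves the leading term.\<close>

lemma act_T_word:
  assumes "set l \<subseteq> {1..<n}" "length l \<le> card (inversions n (snd \<circ> s))" "s \<in> states"
  shows "act (fa_prod (map Tg l)) v0 s = (if snd \<circ> s = inv (perm_of_word l) then 1 else 0)"
  using assms
proof (induction l arbitrary: s)
  case (Cons i l)
  let ?F = "act (fa_prod (map Tg l)) v0" and ?m = "inv (perm_of_word l)"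
  let ?t = "s \<circ> transpose i (Suc i)"
  have i: "1 \<le> i" "i < n" and l: "set l \<subseteq> {1..<n}" using Cons.prems by auto
  have inj: "inj (snd \<circ> s)" using Cons.prems(3) by (auto simp: states_def dest: permutes_inj)
  from Cons.prems(2) card_inversions_transpose_le(2)[OF i inj, unfolded comp_assoc] have "length (i # l) \<le> Suc (card (inversions n (snd \<circ> ?t)))"
    by (rule order_trans)
  then have "length l \<le> card (inversions n (snd \<circ> ?t))" by simp
  then have Ft: "?F ?t = (if snd \<circ> ?t = ?m then 1 else 0)"
    by (rule Cons.IH[OF l _ states_transpose[OF Cons.prems(3) i]])
  have len: "length l < card (inversions n (snd \<circ> s))" using Cons.prems(2) by (simp del: o_apply)
  \<comment> \<open>\<open>l\<close> produces at most \<open>length l\<close> inversions while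
    \<open>s\<close> has more, so \<open>?F\<close> vanishes at \<open>s\<close> and the correction
    at \<open>i\<close> drops out.\<close>
  then have "snd \<circ> s \<noteq> ?m"
    using card_inversions_le_length[OF l] by (metis leD)
  then have Fs: "?F s = 0" using Cons.IH[OF l less_imp_le[OF len] Cons.prems(3)]
    by (simp only: if_False)
  have "set (map Tg l :: 'r fa list) \<subseteq> fa_carrier n" using l by auto
  then have "act (fa_prod (map Tg (i # l))) v0 s = act (Tg i) ?F s"
    using i by (simp add: act_simps)
  also have "\<dots> = ?F ?t" using Fs by simp
  also have "\<dots> = (if snd \<circ> s \<circ> transpose i (Suc i) = ?m then 1 else 0)"
    unfolding Ft by (simp add: comp_assoc)
  also have "snd \<circ> s \<circ> transpose i (Suc i) = ?m \<longleftrightarrow> snd \<circ> s = inv (perm_of_word (i # l))"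
    unfolding comp_transpose_eq_iff inv_perm_of_word_Cons by simp
  finally show ?case .
qed (simp add: v0_def)

section \<open>The Vandermonde matrix on colour words\<close>

abbreviation colourings where "colourings \<equiv> {1..n} \<rightarrow>\<^sub>E {1..r}"
abbreviation exponents where "exponents \<equiv> {1..n} \<rightarrow>\<^sub>E {0..<r}"

lemma finite_exponents [simp]: "finite exponents"
  by (intro finite_PiE) auto

definition t_power :: "(nat \<Rightarrow> nat) \<Rightarrow> 'r fa" where
  "t_power c = fa_prod (map (\<lambda>i. fa_pow (tg i) (c i)) [1..<n+1])"

text \<open>An entry of the \<open>n\<close>-fold tensor power of the Vandermonde matrix; it is the
  eigenvalue of \<open>t^c\<close> on words coloured by \<open>k\<close>.\<close>

definition vandermonde :: "(nat \<Rightarrow> nat) \<Rightarrow> (nat \<Rightarrow> nat) \<Rightarrow> 'r" where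
  "vandermonde c k = (\<Prod>i\<in>{1..n}. u (k i) ^ c i)"

lemma diag_t_power: "diag (t_power c) (\<lambda>s. vandermonde c (fst \<circ> s))"
proof -
  have "diag (t_power c) (\<lambda>s. \<Prod>i\<leftarrow>[1..<n+1]. u (fst (s i)) ^ c i)"
    unfolding t_power_def by (intro diag_prod diag_pow diag_tg) auto
  also have "(\<lambda>s. \<Prod>i\<leftarrow>[1..<n+1]. u (fst (s i)) ^ c i) = (\<lambda>s. vandermonde c (fst \<circ> s))"
    unfolding vandermonde_def set_upt_Suc[symmetric]
    by (subst prod.distinct_set_conv_list) simp_all
  finally show ?thesis .
qed

text \<open>The coefficients of the Lagrange polynomials form the inverse of a Vandermonde matrix;
  this is its \<open>n\<close>-fold tensor power.\<close>

definition vandermonde_inv :: "(nat \<Rightarrow> nat) \<Rightarrow> (nat \<Rightarrow> nat) \<Rightarrow> 'r" where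
  "vandermonde_inv k c = (\<Prod>i\<in>{1..n}. coeff (lag (k i)) (c i))"

lemma prod_indicator:
  "finite A \<Longrightarrow> (\<Prod>i\<in>A. if P i then 1 else 0) = (if \<forall>i\<in>A. P i then 1 else 0 :: 'r)"
  by (induction rule: finite_induct) auto

lemma PiE_eq_iff: "c \<in> A \<rightarrow>\<^sub>E B \<Longrightarrow> c' \<in> A \<rightarrow>\<^sub>E B \<Longrightarrow> (\<forall>i\<in>A. c i = c' i) \<longleftrightarrow> c = c'"
  by (auto intro: PiE_ext)

text \<open>Factor by factor this is the evaluation of a Lagrange polynomial at the nodes. The
  inverse on this side yields solvability.\<close>

lemma vandermonde_inv_left:
  assumes "k \<in> colourings" "k' \<in> colourings"
  shows "(\<Sum>c\<in>exponents. vandermonde_inv k c * vandermonde c k') = (if k = k' then 1 else 0)"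
proof -
  have lag: "(\<Sum>e\<in>{0..<r}. coeff (lag (k i)) e * u (k' i) ^ e) = (if k i = k' i then 1 else 0)"
    if "i \<in> {1..n}" for i
  proof -
    have ki: "k i \<in> {1..r}" "k' i \<in> {1..r}" using assms that by (auto simp: PiE_iff)
    then have "(\<Sum>e\<in>{0..<r}. coeff (lag (k i)) e * u (k' i) ^ e) = poly (lag (k i)) (u (k' i))"
      unfolding poly_altdef using degree_lag[of "k i"]
      by (intro sum.mono_neutral_right) (auto simp: coeff_eq_0)
    with ki show ?thesis by (simp add: poly_lag)
  qed
  have "(\<Sum>c\<in>exponents. vandermonde_inv k c * vandermonde c k')
      = (\<Prod>i\<in>{1..n}. \<Sum>e\<in>{0..<r}. coeff (lag (k i)) e * u (k' i) ^ e)"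
    unfolding vandermonde_def vandermonde_inv_def
    by (subst prod_sum_PiE) (simp_all add: prod.distrib)
  also have "\<dots> = (\<Prod>i\<in>{1..n}. if k i = k' i then 1 else 0)"
    by (rule prod.cong[OF refl lag])
  finally show ?thesis using assms by (simp add: prod_indicator PiE_eq_iff del: atLeastAtMost_iff)
qed

text \<open>Factor by factor this is the Lagrange expansion of the monomial \<open>X^(c i)\<close>,
  compared coefficient by coefficient. The inverse on this side yields independence.\<close>

lemma vandermonde_inv_right:
  assumes "c \<in> exponents" "c' \<in> exponents"
  shows "(\<Sum>k\<in>colourings. vandermonde c k * vandermonde_inv k c') = (if c = c' then 1 else 0)"
proof -
  have lag: "(\<Sum>a\<in>{1..r}. u a ^ c i * coeff (lag a) (c' i)) = (if c i = c' i then 1 else 0)"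
    if "i \<in> {1..n}" for i
  proof -
    have ci: "c i < r" "c' i < r" using assms that by (auto simp: PiE_iff)
    have "(\<Sum>a\<in>{1..r}. smult (u a ^ c i) (lag a)) = monom 1 (c i)"
    proof (rule poly_eq_interpolation)
      have "degree (\<Sum>a\<in>{1..r}. smult (u a ^ c i) (lag a)) \<le> r - 1"
        using r degree_lag by (intro degree_sum_le) (fastforce intro: order_trans[OF degree_smult_le])+
      with r show "degree (\<Sum>a\<in>{1..r}. smult (u a ^ c i) (lag a)) < r" by simp
      show "degree (monom (1::'r) (c i)) < r" using ci by (simp add: degree_monom_eq)
      fix b assume b: "b \<in> {1..r}"
      have "poly (\<Sum>a\<in>{1..r}. smult (u a ^ c i) (lag a)) (u b)
          = (\<Sum>a\<in>{1..r}. if a = b then u a ^ c i else 0)"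
        unfolding poly_sum using b by (intro sum.cong) (auto simp: poly_lag)
      also have "\<dots> = poly (monom 1 (c i)) (u b)"
        using b by (subst sum.delta) (auto simp: poly_monom)
      finally show "poly (\<Sum>a\<in>{1..r}. smult (u a ^ c i) (lag a)) (u b) = poly (monom 1 (c i)) (u b)" .
    qed
    then have "coeff (\<Sum>a\<in>{1..r}. smult (u a ^ c i) (lag a)) (c' i) = coeff (monom 1 (c i)) (c' i)"
      by (rule arg_cong)
    then show ?thesis by (simp add: coeff_sum)
  qed
  have "(\<Sum>k\<in>colourings. vandermonde c k * vandermonde_inv k c')
      = (\<Prod>i\<in>{1..n}. \<Sum>a\<in>{1..r}. u a ^ c i * coeff (lag a) (c' i))"
    unfolding vandermonde_def vandermonde_inv_def
    by (subst prod_sum_PiE) (simp_all add: prod.distrib)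
  also have "\<dots> = (\<Prod>i\<in>{1..n}. if c i = c' i then 1 else 0)"
    by (rule prod.cong[OF refl lag])
  finally show ?thesis using assms by (simp add: prod_indicator PiE_eq_iff del: atLeastAtMost_iff)
qed

lemma vandermonde_independent:
  assumes zero: "\<And>k. k \<in> colourings \<Longrightarrow> (\<Sum>c\<in>exponents. a c * vandermonde c k) = 0"
    and c: "c \<in> exponents"
  shows "a c = 0"
proof -
  have "a c = (\<Sum>c'\<in>exponents. if c' = c then a c' else 0)"
    using c by (simp del: One_nat_def)
  also have "\<dots> = (\<Sum>c'\<in>exponents. a c' * (\<Sum>k\<in>colourings. vandermonde c' k * vandermonde_inv k c))"
    using c by (intro sum.cong) (auto simp: vandermonde_inv_right simp del: One_nat_def)
  also have "\<dots> = (\<Sum>c'\<in>exponents. \<Sum>k\<in>colourings. a c' * vandermonde c' k * vandermonde_inv k c)"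
    by (simp add: sum_distrib_left mult.assoc)
  also have "\<dots> = (\<Sum>k\<in>colourings. \<Sum>c'\<in>exponents. a c' * vandermonde c' k * vandermonde_inv k c)"
    by (rule sum.swap)
  also have "\<dots> = 0" by (simp add: sum_distrib_right[symmetric] zero del: One_nat_def)
  finally show ?thesis .
qed

lemma vandermonde_surjective:
  "\<exists>a. \<forall>k\<in>colourings. (\<Sum>c\<in>exponents. a c * vandermonde c k) = \<phi> k"
proof (intro exI ballI)
  fix k assume k: "k \<in> colourings"
  have "(\<Sum>c\<in>exponents. (\<Sum>k'\<in>colourings. \<phi> k' * vandermonde_inv k' c) * vandermonde c k)
      = (\<Sum>c\<in>exponents. \<Sum>k'\<in>colourings. \<phi> k' * (vandermonde_inv k' c * vandermonde c k))"
    by (simp add: sum_distrib_right mult.assoc)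
  also have "\<dots> = (\<Sum>k'\<in>colourings. \<Sum>c\<in>exponents. \<phi> k' * (vandermonde_inv k' c * vandermonde c k))"
    by (rule sum.swap)
  also have "\<dots> = (\<Sum>k'\<in>colourings. if k' = k then \<phi> k' else 0)"
    unfolding sum_distrib_left[symmetric] using k
    by (intro sum.cong) (auto simp: vandermonde_inv_left simp del: One_nat_def)
  also have "\<dots> = \<phi> k" using k by (simp del: One_nat_def)
  finally show "(\<Sum>c\<in>exponents. (\<Sum>k'\<in>colourings. \<phi> k' * vandermonde_inv k' c) * vandermonde c k) = \<phi> k" .
qed

lemma state_of_pair:
  assumes "k \<in> colourings" "m permutes {1..n}"
  shows "(\<lambda>i. (k i, m i)) \<in> states"
  using assms by (simp add: states_def comp_def)

lemma finite_Idx: "finite (Idx n r)"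
  unfolding Idx_def by (intro finite_cartesian_product finite_PiE finite_permutations) auto

lemma mon_eq: "mon n r q u (c, w) = fa_mult (t_power c) (gw n r q u w)"
  by (simp add: mon_def t_power_def del: upt_Suc)

lemma gw_carrier:
  assumes "w permutes {1..n}"
  shows "gw n r q u w \<in> fa_carrier n"
  unfolding gw_def using reduced_word_some(1)[OF assms] by (intro fa_carrier_prod) auto

lemma mon_carrier: "i \<in> Idx n r \<Longrightarrow> mon n r q u i \<in> fa_carrier n"
  by (cases i) (auto simp: mon_eq Idx_def intro!: fa_carrier_mult gw_carrier diag_carrier[OF diag_t_power])

lemma act_mon:
  assumes w: "w permutes {1..n}" and s: "s \<in> states"
  shows "act (mon n r q u (c, w)) v0 s = (if inv (snd \<circ> s) = w then vandermonde c (fst \<circ> s) else 0)"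
proof -
  have "act (gw n r q u w) v0 s = (if snd \<circ> s = inv w then 1 else 0)"
    unfolding gw_def using reduced_word_some[OF w] s by (subst act_g_word) auto
  moreover have "snd \<circ> s = inv w \<longleftrightarrow> inv (snd \<circ> s) = w"
    using w s by (auto simp: states_def permutes_inv_inv)
  ultimately show ?thesis
    using gw_carrier[OF w]
    by (simp add: mon_eq act_simps diag_carrier[OF diag_t_power] diagD[OF diag_t_power])
qed

text \<open>The labels of a state single out one permutation, so a linear relation splits into a
  separate Vandermonde system for each \<open>w\<close>.\<close>

lemma act_sum_mon:
  assumes s: "s \<in> states"
  shows "act (fa_sum (\<lambda>i. fa_smul (a i) (mon n r q u i)) (Idx n r)) v0 s
    = (\<Sum>c\<in>exponents. a (c, inv (snd \<circ> s)) * vandermonde c (fst \<circ> s))"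
proof -
  let ?W = "{w. w permutes {1..n}}"
  have fin: "finite ?W" by (rule finite_permutations) simp
  have w: "inv (snd \<circ> s) \<in> ?W" using s by (simp add: states_def permutes_inv)
  have "act (fa_sum (\<lambda>i. fa_smul (a i) (mon n r q u i)) (Idx n r)) v0 s
      = (\<Sum>i\<in>Idx n r. a i * act (mon n r q u i) v0 s)"
    using act_sum[where n = n, OF _ finite_Idx, of "\<lambda>i. fa_smul (a i) (mon n r q u i)"]
    by (simp add: mon_carrier act_simps)
  also have "\<dots> = (\<Sum>c\<in>exponents. \<Sum>w\<in>?W. a (c, w) * act (mon n r q u (c, w)) v0 s)"
    by (simp add: Idx_def sum.cartesian_product split_def)
  also have "\<dots> = (\<Sum>c\<in>exponents. \<Sum>w\<in>?W. if inv (snd \<circ> s) = w then a (c, w) * vandermonde c (fst \<circ> s) else 0)"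
    using s by (intro sum.cong) (auto simp: act_mon)
  also have "\<dots> = (\<Sum>c\<in>exponents. a (c, inv (snd \<circ> s)) * vandermonde c (fst \<circ> s))"
    using w fin by (simp add: sum.delta' del: mem_Collect_eq)
  finally show ?thesis .
qed

section \<open>Independence of the \<open>t\<close>-\<open>T\<close> normal forms\<close>

abbreviation normal where "normal \<equiv> normal_words (n - 1)"

lemma normal_props:
  assumes "l \<in> normal"
  shows "set l \<subseteq> {1..<n}" "card (inversions n (inv (perm_of_word l))) = length l"
    "perm_of_word l permutes {1..n}"
proof -
  have "{1..n-1} \<subseteq> {1..<n}" using n by auto
  with set_normal_word[OF assms] show l: "set l \<subseteq> {1..<n}" by (rule subset_trans)
  show "card (inversions n (inv (perm_of_word l))) = length l"
    using assms n by (intro card_inversions_normal_word) auto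
  show "perm_of_word l permutes {1..n}" by (rule perm_of_word_permutes[OF l])
qed

definition T_mon :: "(nat \<Rightarrow> nat) \<times> nat list \<Rightarrow> 'r fa" where
  "T_mon = (\<lambda>(c, l). fa_mult (t_power c) (fa_prod (map Tg l)))"

lemma T_word_carrier: "l \<in> normal \<Longrightarrow> (fa_prod (map Tg l) :: 'r fa) \<in> fa_carrier n"
  using normal_props(1) by (intro fa_carrier_prod) fastforce

lemma T_mon_carrier: "i \<in> exponents \<times> normal \<Longrightarrow> T_mon i \<in> fa_carrier n"
  by (auto simp: T_mon_def intro!: fa_carrier_mult T_word_carrier diag_carrier[OF diag_t_power])

text \<open>Among the nonzero coefficients consider those at a word of maximal length: they are the only
  ones visible on states labelled by the inverse of its permutation.\<close>

lemma T_mon_independent: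
  assumes zero: "\<And>s. s \<in> states \<Longrightarrow>
      act (fa_sum (\<lambda>i. fa_smul (a i) (T_mon i)) (exponents \<times> normal)) v0 s = 0"
    and i: "i \<in> exponents \<times> normal"
  shows "a i = 0"
proof (rule ccontr)
  assume nz: "a i \<noteq> 0"
  let ?L = "{l \<in> normal. \<exists>c\<in>exponents. a (c, l) \<noteq> 0}"
  have fin: "finite ?L" by simp
  have "snd i \<in> ?L" using nz i by force
  then have "Max (length ` ?L) \<in> length ` ?L" using fin by (intro Max_in) auto
  then obtain l where l: "l \<in> ?L" and "length l = Max (length ` ?L)" by force
  then have longest: "length l' \<le> length l" if "l' \<in> ?L" for l' using that fin by simp
  have ln: "l \<in> normal" using l by simp
  let ?m = "inv (perm_of_word l)"
  have "(\<Sum>c\<in>exponents. a (c, l) * vandermonde c k) = 0" if k: "k \<in> colourings" for k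
  proof -
    define s where "s = (\<lambda>i. (k i, ?m i))"
    have s: "s \<in> states" and fst: "fst \<circ> s = k" and snd: "snd \<circ> s = ?m"
      unfolding s_def using normal_props(3)[OF ln]
      by (intro state_of_pair k permutes_inv) (auto simp: comp_def)
    have T: "a (c, l') * act (T_mon (c, l')) v0 s = (if l = l' then a (c, l') * vandermonde c k else 0)"
      if c: "c \<in> exponents" and l': "l' \<in> normal" for c l'
    proof (cases "a (c, l') = 0")
      case False
      with c l' have "l' \<in> ?L" by auto
      \<comment> \<open>Maximality of \<open>length l\<close> among the words with a nonzero
        coefficient is exactly the bound under which \<open>act_T_word\<close> can be applied at
        \<open>s\<close>.\<close>
      then have "length l' \<le> card (inversions n (snd \<circ> s))"
        using longest normal_props(2)[OF ln] by (simp add: snd)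
      then have "act (fa_prod (map Tg l')) v0 s = (if ?m = inv (perm_of_word l') then 1 else 0)"
        using normal_props(1)[OF l'] s by (subst act_T_word) (auto simp: snd)
      also have "?m = inv (perm_of_word l') \<longleftrightarrow> l = l'"
        using normal_props(3)[OF ln] normal_props(3)[OF l'] inj_onD[OF inj_on_perm_of_normal_word _ ln l']
        by (metis permutes_inv_inv)
      finally show ?thesis
        using T_word_carrier[OF l'] fst
        by (simp add: T_mon_def act_simps diag_carrier[OF diag_t_power] diagD[OF diag_t_power])
    qed simp
    have "0 = (\<Sum>i\<in>exponents \<times> normal. a i * act (T_mon i) v0 s)"
      using zero[OF s] act_sum[where n = n, of "exponents \<times> normal" "\<lambda>i. fa_smul (a i) (T_mon i)"]
      by (simp add: T_mon_carrier act_simps del: One_nat_def)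
    also have "\<dots> = (\<Sum>c\<in>exponents. \<Sum>l'\<in>normal. a (c, l') * act (T_mon (c, l')) v0 s)"
      by (simp add: sum.cartesian_product split_def)
    also have "\<dots> = (\<Sum>c\<in>exponents. \<Sum>l'\<in>normal. if l = l' then a (c, l') * vandermonde c k else 0)"
      by (intro sum.cong refl T)
    also have "\<dots> = (\<Sum>c\<in>exponents. a (c, l) * vandermonde c k)"
      using ln by simp
    finally show ?thesis by simp
  qed
  then have "\<forall>c\<in>exponents. a (c, l) = 0"
    using vandermonde_independent[of "\<lambda>c. a (c, l)"] by blast
  with l show False by auto
qed

end

section \<open>A spanning set\<close>

lemma upt_split: "i \<le> j \<Longrightarrow> j \<le> k \<Longrightarrow> [i..<k] = [i..<j] @ [j..<k]"
  using upt_add_eq_append[of i j "k - j"] by simp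

lemma fa_mult_gen_Cons: "fa_mult (fa_gen g) p (x # w) = (if x = g then p w else 0)"
proof -
  have "(\<lambda>v. fa_gen g (x # v)) = (if x = g then fa_one else (\<lambda>_. 0 :: 'a))"
    by (auto simp: fa_gen_def fa_one_def)
  moreover have "fa_mult (\<lambda>_. 0) p w = 0" by (simp add: fa_mult_def)
  ultimately show ?thesis
    by (simp add: fa_mult_Cons fa_mult_one_left) (simp add: fa_gen_def)
qed

lemma fa_prod_gen: "fa_prod (map fa_gen w) v = (if v = w then 1 else 0)"
proof (induction w arbitrary: v)
  case (Cons g w)
  then show ?case by (cases v) (simp_all add: fa_mult_gen_Cons, simp add: fa_gen_def)
qed (simp add: fa_one_def)

lemma fa_expand:
  assumes "finite {w. p w \<noteq> 0}"
  shows "p = fa_sum (\<lambda>w. fa_smul (p w) (fa_prod (map fa_gen w))) {w. p w \<noteq> 0}"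
proof
  fix v
  have "fa_sum (\<lambda>w. fa_smul (p w) (fa_prod (map fa_gen w))) {w. p w \<noteq> 0} v
      = (\<Sum>w | p w \<noteq> 0. if v = w then p w else 0)"
    unfolding fa_sum_def fa_smul_def fa_prod_gen by (intro sum.cong) auto
  also have "\<dots> = p v" using assms by simp
  finally show "p v = fa_sum (\<lambda>w. fa_smul (p w) (fa_prod (map fa_gen w))) {w. p w \<noteq> 0} v" ..
qed

lemma fa_ideal_mult_left:
  assumes "a \<in> fa_carrier n" "x \<in> fa_ideal n S"
  shows "fa_mult a x \<in> fa_ideal n S"
  using assms(2)
proof (induction rule: fa_ideal.induct)
  case zero
  have "fa_mult a (\<lambda>_. 0) = (\<lambda>_. 0)" by (simp add: fa_mult_def)
  then show ?case using fa_ideal.zero by metis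
next
  case (gen s b c)
  then show ?case
    using fa_ideal.gen[of s S "fa_mult a b" n c] assms(1) by (simp add: fa_mult_assoc)
next
  case (add x y)
  have "fa_mult a (fa_add x y) = fa_add (fa_mult a x) (fa_mult a y)"
    by (auto simp: fa_add_def fa_mult_add_right)
  with add show ?case by (simp add: fa_ideal.add)
qed

lemma fa_ideal_mult_right:
  assumes "a \<in> fa_carrier n" "x \<in> fa_ideal n S"
  shows "fa_mult x a \<in> fa_ideal n S"
  using assms(2)
proof (induction rule: fa_ideal.induct)
  case zero
  have "fa_mult (\<lambda>_. 0) a = (\<lambda>_. 0)" by (simp add: fa_mult_def)
  then show ?case using fa_ideal.zero by metis
next
  case (gen s b c)
  then show ?case
    using fa_ideal.gen[of s S b n "fa_mult c a"] assms(1) by (simp add: fa_mult_assoc)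
next
  case (add x y)
  have "fa_mult (fa_add x y) a = fa_add (fa_mult x a) (fa_mult y a)"
    by (auto simp: fa_add_def fa_mult_add_left)
  with add show ?case by (simp add: fa_ideal.add)
qed

lemma fa_ideal_incl: "s \<in> S \<Longrightarrow> s \<in> fa_ideal n S"
  using fa_ideal.gen[of s S fa_one n fa_one] by (simp add: fa_mult_one_left fa_mult_one_right)

context shoji
begin

section \<open>Congruences and spans modulo the defining ideal\<close>

definition carr :: "'r ncser set" where
  "carr = {x. coef x \<in> fa_carrier n}"

definition ideal :: "'r ncser set" where
  "ideal = {x. coef x \<in> H_ideal n r q u}"

lemma ser_carr [simp]: "ser p \<in> carr \<longleftrightarrow> p \<in> fa_carrier n"
  by (simp add: carr_def ser_inverse)

lemma ser_ideal: "ser p \<in> ideal \<longleftrightarrow> p \<in> H_ideal n r q u"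
  by (simp add: ideal_def ser_inverse)

lemma carr_mult [simp]: "x \<in> carr \<Longrightarrow> y \<in> carr \<Longrightarrow> x * y \<in> carr"
  by (simp add: carr_def times_ncser.rep_eq)

lemma carr_add [simp]: "x \<in> carr \<Longrightarrow> y \<in> carr \<Longrightarrow> x + y \<in> carr"
  by (simp add: carr_def plus_ncser.rep_eq)

lemma carr_scal [simp]: "scal a \<in> carr"
  by (simp add: carr_def scal.rep_eq)

lemma carr_one [simp]: "1 \<in> carr"
  by (simp add: carr_def one_ncser.rep_eq)

lemma carr_gen [simp]: "valid_gen n g \<Longrightarrow> gen g \<in> carr"
  by (simp add: carr_def gen.rep_eq)

lemma carr_prod_list [simp]: "set xs \<subseteq> carr \<Longrightarrow> prod_list xs \<in> carr"
  by (induction xs) simp_all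

lemma carr_power [simp]: "x \<in> carr \<Longrightarrow> x ^ k \<in> carr"
  by (induction k) simp_all

lemma ideal_zero [simp]: "0 \<in> ideal"
  by (simp add: ideal_def zero_ncser.rep_eq H_ideal_def fa_ideal.zero)

lemma ideal_add: "x \<in> ideal \<Longrightarrow> y \<in> ideal \<Longrightarrow> x + y \<in> ideal"
  by (simp add: ideal_def plus_ncser.rep_eq H_ideal_def fa_ideal.add)

lemma ideal_mult_left: "a \<in> carr \<Longrightarrow> x \<in> ideal \<Longrightarrow> a * x \<in> ideal"
  by (simp add: ideal_def carr_def times_ncser.rep_eq H_ideal_def fa_ideal_mult_left)

lemma ideal_mult_right: "a \<in> carr \<Longrightarrow> x \<in> ideal \<Longrightarrow> x * a \<in> ideal"
  by (simp add: ideal_def carr_def times_ncser.rep_eq H_ideal_def fa_ideal_mult_right)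

text \<open>Negatives are not among the rules of \<open>fa_ideal\<close>; they come from
  multiplication by the scalar -1.\<close>

lemma ideal_uminus: "x \<in> ideal \<Longrightarrow> - x \<in> ideal"
  using ideal_mult_left[OF carr_scal[of "- 1"]] by (simp add: scal_minus)

lemma hrel_ideal: "x \<in> hrel n r q u \<Longrightarrow> ser x \<in> ideal"
  by (simp add: ser_ideal H_ideal_def fa_ideal_incl)

definition eqv :: "'r ncser \<Rightarrow> 'r ncser \<Rightarrow> bool" (infix \<open>\<approx>\<close> 50) where
  "x \<approx> y \<longleftrightarrow> x - y \<in> ideal"

lemma eqv_refl [simp]: "x \<approx> x"
  by (simp add: eqv_def)

lemma eqv_sym: "x \<approx> y \<Longrightarrow> y \<approx> x"
  using ideal_uminus[of "x - y"] by (simp add: eqv_def)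

lemma eqv_trans [trans]: "x \<approx> y \<Longrightarrow> y \<approx> z \<Longrightarrow> x \<approx> z"
  using ideal_add[of "x - y" "y - z"] by (simp add: eqv_def)

lemma eqv_add: "x \<approx> y \<Longrightarrow> x' \<approx> y' \<Longrightarrow> x + x' \<approx> y + y'"
  using ideal_add[of "x - y" "x' - y'"] by (simp add: eqv_def algebra_simps)

lemma eqv_mult_left: "x \<approx> y \<Longrightarrow> a \<in> carr \<Longrightarrow> a * x \<approx> a * y"
  using ideal_mult_left[of a "x - y"] by (simp add: eqv_def right_diff_distrib)

lemma eqv_mult_right: "x \<approx> y \<Longrightarrow> a \<in> carr \<Longrightarrow> x * a \<approx> y * a"
  using ideal_mult_right[of a "x - y"] by (simp add: eqv_def left_diff_distrib)

text \<open>The ideal is built in, so membership means being congruent to an \<open>R\<close>-linear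
  combination of elements of \<open>S\<close>.\<close>

inductive_set span :: "'r ncser set \<Rightarrow> 'r ncser set" for S where
  ideal: "x \<in> ideal \<Longrightarrow> x \<in> span S"
| base: "x \<in> S \<Longrightarrow> x \<in> span S"
| add: "x \<in> span S \<Longrightarrow> y \<in> span S \<Longrightarrow> x + y \<in> span S"
| scale: "x \<in> span S \<Longrightarrow> scal a * x \<in> span S"

lemma span_uminus: "x \<in> span S \<Longrightarrow> - x \<in> span S"
  using span.scale[of x S "- 1"] by (simp add: scal_minus)

lemma span_diff: "x \<in> span S \<Longrightarrow> y \<in> span S \<Longrightarrow> x - y \<in> span S"
  using span.add[of x S "- y"] span_uminus by simp

lemma span_sum: "(\<And>i. i \<in> A \<Longrightarrow> f i \<in> span S) \<Longrightarrow> (\<Sum>i\<in>A. f i) \<in> span S"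
  by (induction A rule: infinite_finite_induct) (auto intro: span.intros)

lemma span_eqv: "x \<approx> y \<Longrightarrow> y \<in> span S \<Longrightarrow> x \<in> span S"
  using span.add[OF span.ideal, of "x - y" y S] by (simp add: eqv_def)

text \<open>Reduces a multiplication to the spanning elements, with a possibly different target
  \<open>S'\<close>; the rewriting arguments below are phrased this way.\<close>

lemma span_mult_left:
  assumes "x \<in> span S" "a \<in> carr" "\<And>s. s \<in> S \<Longrightarrow> a * s \<in> span S'"
  shows "a * x \<in> span S'"
  using assms(1)
proof (induction rule: span.induct)
  case (ideal x)
  then show ?case using assms(2) by (intro span.ideal ideal_mult_left)
next
  case (scale x c)
  then show ?case using span.scale by (simp add: scal_left_commute)
qed (auto simp: distrib_left assms(3) intro: span.add)

lemma span_mult_right: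
  assumes "x \<in> span S" "a \<in> carr" "\<And>s. s \<in> S \<Longrightarrow> s * a \<in> span S'"
  shows "x * a \<in> span S'"
  using assms(1)
proof (induction rule: span.induct)
  case (ideal x)
  then show ?case using assms(2) by (intro span.ideal ideal_mult_right)
next
  case (scale x c)
  then show ?case using span.scale by (simp add: mult.assoc)
qed (auto simp: distrib_right assms(3) intro: span.add)

lemma span_trans:
  assumes "x \<in> span S" "\<And>s. s \<in> S \<Longrightarrow> s \<in> span S'"
  shows "x \<in> span S'"
  using span_mult_left[OF assms(1), of 1] assms(2) by simp

lemma span_finite_image:
  assumes "x \<in> span (f ` A)" "finite A"
  shows "\<exists>a. x \<approx> (\<Sum>i\<in>A. scal (a i) * f i)"
  using assms(1)
proof (induction rule: span.induct)
  case (ideal x)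
  then show ?case by (intro exI[of _ "\<lambda>_. 0"]) (simp add: eqv_def)
next
  case (base x)
  then obtain j where j: "j \<in> A" "x = f j" by auto
  have "(\<Sum>i\<in>A. scal (if i = j then 1 else 0) * f i) = (\<Sum>i\<in>A. if i = j then f i else 0)"
    by (intro sum.cong) auto
  also have "\<dots> = x" using j assms(2) by simp
  finally show ?case by (metis eqv_refl)
next
  case (add x y)
  then obtain a b where "x \<approx> (\<Sum>i\<in>A. scal (a i) * f i)" "y \<approx> (\<Sum>i\<in>A. scal (b i) * f i)" by blast
  from eqv_add[OF this] show ?case
    by (intro exI[of _ "\<lambda>i. a i + b i"]) (simp add: scal_add distrib_right sum.distrib)
next
  case (scale x c)
  then obtain a where "x \<approx> (\<Sum>i\<in>A. scal (a i) * f i)" by blast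
  then have "scal c * x \<approx> scal c * (\<Sum>i\<in>A. scal (a i) * f i)" by (rule eqv_mult_left) simp
  then show ?case
    by (intro exI[of _ "\<lambda>i. c * a i"]) (simp add: scal_mult sum_distrib_left mult.assoc)
qed

section \<open>The defining relations as congruences\<close>

abbreviation t :: "nat \<Rightarrow> 'r ncser" where "t i \<equiv> gen (Gt i)"
abbreviation T :: "nat \<Rightarrow> 'r ncser" where "T i \<equiv> gen (GT i)"

lemma t_carr [simp]: "1 \<le> i \<Longrightarrow> i \<le> n \<Longrightarrow> t i \<in> carr"
  and T_carr [simp]: "1 \<le> i \<Longrightarrow> i < n \<Longrightarrow> T i \<in> carr"
  by (auto simp: valid_gen_def)

lemma T_square:
  assumes "1 \<le> i" "i < n"
  shows "T i * T i \<approx> scal h * T i + 1"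
proof -
  have "fa_mult (fa_minus (Tg i) (fa_scal q)) (fa_add (Tg i) (fa_scal (rinv q))) \<in> hrel n r q u"
    unfolding hrel_def using assms by (intro UnI1 CollectI exI[of _ i]) auto
  from hrel_ideal[OF this] have "(T i - scal q) * (T i + scal (rinv q)) \<in> ideal"
    by (simp add: ser_simps)
  also have "(T i - scal q) * (T i + scal (rinv q)) = T i * T i - (scal h * T i + scal (q * rinv q))"
    by (simp add: algebra_simps scal_diff scal_mult scal_commute[of "T i"] del: q_rinv)
  finally show ?thesis by (simp add: eqv_def)
qed

lemma t_char_poly:
  assumes "1 \<le> i" "i \<le> n"
  shows "(\<Prod>c\<leftarrow>[1..<r+1]. t i - scal (u c)) \<in> ideal"
proof -
  have "fa_prod (map (\<lambda>c. fa_minus (tg i) (fa_scal (u c))) [1..<r+1]) \<in> hrel n r q u"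
    unfolding hrel_def using assms by blast
  from hrel_ideal[OF this] show ?thesis by (simp add: ser_simps comp_def del: upt_Suc)
qed

lemma T_braid:
  assumes "1 \<le> i" "Suc i < n"
  shows "T i * (T (Suc i) * T i) \<approx> T (Suc i) * (T i * T (Suc i))"
proof -
  have "fa_minus (fa_prod [Tg i, Tg (i+1), Tg i]) (fa_prod [Tg (i+1), Tg i, Tg (i+1)]) \<in> hrel n r q u"
    unfolding hrel_def using assms by (intro UnI1[OF UnI1[OF UnI1[OF UnI1[OF UnI1[OF UnI2]]]]]) auto
  from hrel_ideal[OF this] show ?thesis by (simp add: ser_simps eqv_def)
qed

lemma T_commute:
  assumes "1 \<le> i" "i < n" "1 \<le> j" "j < n" "i + 2 \<le> j \<or> j + 2 \<le> i"
  shows "T i * T j \<approx> T j * T i"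
proof -
  have "fa_minus (fa_mult (Tg i) (Tg j)) (fa_mult (Tg j) (Tg i)) \<in> hrel n r q u"
    unfolding hrel_def using assms by (intro UnI1[OF UnI1[OF UnI1[OF UnI1[OF UnI2]]]] CollectI exI[of _ i] exI[of _ j]) auto
  from hrel_ideal[OF this] show ?thesis by (simp add: ser_simps eqv_def)
qed

lemma t_commute:
  assumes "1 \<le> i" "i \<le> n" "1 \<le> j" "j \<le> n"
  shows "t i * t j \<approx> t j * t i"
proof -
  have "fa_minus (fa_mult (tg i) (tg j)) (fa_mult (tg j) (tg i)) \<in> hrel n r q u"
    unfolding hrel_def using assms by blast
  from hrel_ideal[OF this] show ?thesis by (simp add: ser_simps eqv_def)
qed

lemma T_t_commute:
  assumes "1 \<le> j" "j < n" "1 \<le> k" "k \<le> n" "k \<noteq> j" "k \<noteq> Suc j"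
  shows "T j * t k \<approx> t k * T j"
proof -
  have "fa_minus (fa_mult (Tg j) (tg k)) (fa_mult (tg k) (Tg j)) \<in> hrel n r q u"
    unfolding hrel_def using assms by (intro UnI1[OF UnI1[OF UnI2]] CollectI exI[of _ j] exI[of _ k]) auto
  from hrel_ideal[OF this] show ?thesis by (simp add: ser_simps eqv_def)
qed

lemma T_t_Suc:
  assumes "1 \<le> i" "i < n"
  shows "T i * t (Suc i) \<approx> t i * T i + ser (corr r q u (Suc i))"
proof -
  have "fa_minus (fa_minus (fa_mult (Tg (Suc i - 1)) (tg (Suc i))) (fa_mult (tg (Suc i - 1)) (Tg (Suc i - 1))))
      (corr r q u (Suc i)) \<in> hrel n r q u"
    unfolding hrel_def using assms by (intro UnI1[OF UnI2] CollectI exI[of _ "Suc i"]) auto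
  from hrel_ideal[OF this] show ?thesis by (simp add: ser_simps eqv_def algebra_simps)
qed

lemma T_t_same:
  assumes "1 \<le> i" "i < n"
  shows "T i * t i \<approx> t (Suc i) * T i - ser (corr r q u (Suc i))"
proof -
  have "fa_add (fa_minus (fa_mult (Tg (Suc i - 1)) (tg (Suc i - 1))) (fa_mult (tg (Suc i)) (Tg (Suc i - 1))))
      (corr r q u (Suc i)) \<in> hrel n r q u"
    unfolding hrel_def using assms by (intro UnI2 CollectI exI[of _ "Suc i"]) auto
  from hrel_ideal[OF this] show ?thesis by (simp add: ser_simps eqv_def algebra_simps)
qed

section \<open>Moving \<open>T\<close> to the right of the \<open>t\<close>\<close>

definition t_word :: "nat list \<Rightarrow> 'r ncser" where
  "t_word w = (\<Prod>i\<leftarrow>w. t i)"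

text \<open>Order and exponents stay unrestricted: pushing \<open>T_i\<close> through creates
  correction polynomials in the \<open>t\<close>, and reduction to \<open>t_mon\<close> waits until
  \<open>T_i\<close> is out of the way.\<close>

definition t_words :: "'r ncser set" where
  "t_words = t_word ` {w. set w \<subseteq> {1..n}}"

lemma t_words_carr: "x \<in> t_words \<Longrightarrow> x \<in> carr"
proof -
  assume "x \<in> t_words"
  then obtain w where w: "set w \<subseteq> {1..n}" "x = t_word w" by (auto simp: t_words_def)
  have "t i \<in> carr" if "i \<in> set w" for i
    using subsetD[OF w(1) that] by simp
  then show ?thesis unfolding w(2) t_word_def by (intro carr_prod_list) auto
qed

lemma t_words_mult: "x \<in> t_words \<Longrightarrow> y \<in> t_words \<Longrightarrow> x * y \<in> t_words"
proof -
  assume "x \<in> t_words" "y \<in> t_words"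
  then obtain v w where "x = t_word v" "y = t_word w" "set v \<subseteq> {1..n}" "set w \<subseteq> {1..n}"
    unfolding t_words_def by auto
  then show ?thesis unfolding t_words_def by (intro image_eqI[of _ _ "v @ w"]) (auto simp: t_word_def)
qed

lemma t_in_t_words: "1 \<le> i \<Longrightarrow> i \<le> n \<Longrightarrow> t i \<in> t_words"
  unfolding t_words_def by (intro image_eqI[of _ _ "[i]"]) (auto simp: t_word_def)

lemma one_in_t_words: "1 \<in> t_words"
  unfolding t_words_def by (intro image_eqI[of _ _ "[]"]) (auto simp: t_word_def)

lemma ideal_carr: "x \<in> ideal \<Longrightarrow> x \<in> carr"
proof -
  assume "x \<in> ideal"
  then have "coef x \<in> fa_ideal n (hrel n r q u)" by (simp add: ideal_def H_ideal_def)
  then have "coef x \<in> fa_carrier n"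
  proof (induction rule: fa_ideal.induct)
    case (gen s a b)
    then show ?case using hrel_carrier by auto
  qed simp_all
  then show ?thesis by (simp add: carr_def)
qed

lemma span_carr:
  assumes "x \<in> span S" "S \<subseteq> carr"
  shows "x \<in> carr"
  using assms(1) by (induction rule: span.induct) (use assms(2) ideal_carr in auto)

lemma span_t_words_carr: "x \<in> span t_words \<Longrightarrow> x \<in> carr"
  by (rule span_carr) (auto intro: t_words_carr)

lemma span_t_words_mult:
  assumes "x \<in> span t_words" "y \<in> span t_words"
  shows "x * y \<in> span t_words"
proof (rule span_mult_right[OF assms(1) span_t_words_carr[OF assms(2)]])
  show "s * y \<in> span t_words" if "s \<in> t_words" for s
    by (rule span_mult_left[OF assms(2) t_words_carr[OF that]])
      (rule span.base[OF t_words_mult[OF that]])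
qed

lemma span_t_words_power:
  assumes "x \<in> span t_words"
  shows "x ^ k \<in> span t_words"
  by (induction k) (auto intro: assms span_t_words_mult span.base one_in_t_words)

lemma corr_span:
  assumes "1 \<le> i" "i < n"
  shows "ser (corr r q u (Suc i)) \<in> span t_words"
proof -
  have fin: "finite {(c1,c2). 1 \<le> c1 \<and> c1 < c2 \<and> c2 \<le> r}"
    by (rule finite_subset[of _ "{1..r} \<times> {1..r}"]) auto
  have poly: "ser (fa_poly p (tg k)) \<in> span t_words" if "1 \<le> k" "k \<le> n" for p and k
    unfolding ser_poly ser_gen using that
    by (intro span_sum span.scale span_t_words_power span.base t_in_t_words)
  show ?thesis
    unfolding corr_def ser_sum[OF fin] using assms
    by (intro span_sum) (auto simp: ser_smul ser_mult intro!: span.scale span_t_words_mult poly)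
qed

text \<open>\<open>T_i\<close> moves right one letter at a time. It either survives to the right end
  or is consumed by a correction, which is a polynomial in the \<open>t\<close>.\<close>

lemma T_t_word:
  assumes i: "1 \<le> i" "i < n" and x: "x \<in> t_words"
  shows "T i * x \<in> span ((\<lambda>x. x * T i) ` t_words \<union> t_words)"
proof -
  let ?S = "(\<lambda>x. x * T i) ` t_words \<union> t_words"
  obtain w where w: "set w \<subseteq> {1..n}" "x = t_word w" using x by (auto simp: t_words_def)
  have t_closed: "t k * y \<in> span ?S" if "y \<in> span ?S" "1 \<le> k" "k \<le> n" for k y
  proof (rule span_mult_left[OF that(1)])
    have "t k * z \<in> t_words" if "z \<in> t_words" for z
      using that \<open>1 \<le> k\<close> \<open>k \<le> n\<close> by (intro t_words_mult t_in_t_words)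
    then show "t k * s \<in> span ?S" if "s \<in> ?S" for s
      using that by (auto simp: mult.assoc[symmetric] intro!: span.base)
  qed (use that in simp)
  have corr_closed: "ser (corr r q u (Suc i)) * y \<in> span ?S" if "y \<in> t_words" for y
    using span_t_words_mult[OF corr_span[OF i] span.base[OF that]]
    by (rule span_trans) (auto intro: span.base)
  have "T i * t_word w \<in> span ?S"
    using w(1)
  proof (induction w)
    case Nil
    have "1 * T i \<in> ?S" using one_in_t_words by blast
    then show ?case by (auto simp: t_word_def intro: span.base)
  next
    case (Cons k w)
    have k: "1 \<le> k" "k \<le> n" and IH: "T i * t_word w \<in> span ?S" using Cons by auto
    have w: "t_word w \<in> t_words" using Cons.prems by (auto simp: t_words_def)
    note wc = t_words_carr[OF w]
    consider "k = i" | "k = Suc i" | "k \<noteq> i" "k \<noteq> Suc i" by blast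
    then have "(T i * t k) * t_word w \<in> span ?S"
    proof cases
      case 1
      have "(T i * t k) * t_word w \<approx> (t (Suc i) * T i - ser (corr r q u (Suc i))) * t_word w"
        unfolding 1 using i by (intro eqv_mult_right[OF T_t_same wc])
      then show ?thesis
        by (rule span_eqv)
          (use i IH w in \<open>simp add: left_diff_distrib mult.assoc span_diff t_closed corr_closed\<close>)
    next
      case 2
      have "(T i * t k) * t_word w \<approx> (t i * T i + ser (corr r q u (Suc i))) * t_word w"
        unfolding 2 using i by (intro eqv_mult_right[OF T_t_Suc wc])
      then show ?thesis
        by (rule span_eqv)
          (use i IH w in \<open>simp add: distrib_right mult.assoc span.add t_closed corr_closed\<close>)
    next
      case 3
      have "(T i * t k) * t_word w \<approx> (t k * T i) * t_word w"
        using i k 3 by (intro eqv_mult_right[OF T_t_commute wc])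
      then show ?thesis
        by (rule span_eqv) (use k IH in \<open>simp add: mult.assoc t_closed\<close>)
    qed
    then show ?case by (simp add: t_word_def mult.assoc)
  qed
  with w show ?thesis by simp
qed

section \<open>Sorting the \<open>t\<close> and bounding their exponents\<close>

lemma prod_linear_factors:
  assumes x: "x \<in> carr"
  shows "(\<Prod>c\<leftarrow>cs. x - scal (v c)) - x ^ length cs \<in> span ((\<lambda>e. x ^ e) ` {..<length cs})"
proof (induction cs)
  case (Cons c cs)
  let ?m = "length cs"
  let ?S = "(\<lambda>e. x ^ e) ` {..<Suc ?m}"
  define L where "L = (\<Prod>c\<leftarrow>cs. x - scal (v c)) - x ^ ?m"
  have L: "L \<in> span ((\<lambda>e. x ^ e) ` {..<?m})" unfolding L_def by (rule Cons)
  have "x * L \<in> span ?S"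
  proof (rule span_mult_left[OF L x])
    fix s assume "s \<in> (\<lambda>e. x ^ e) ` {..<?m}"
    then obtain e where "s = x ^ e" "e < ?m" by auto
    then have "x * s = x ^ Suc e" "Suc e \<in> {..<Suc ?m}" by simp_all
    then show "x * s \<in> span ?S" by (intro span.base) (rule image_eqI)
  qed
  moreover have "x ^ ?m \<in> span ?S" by (intro span.base) auto
  moreover have "L \<in> span ?S" using L by (rule span_trans) (auto intro: span.base)
  ultimately have "x * L - scal (v c) * x ^ ?m - scal (v c) * L \<in> span ?S"
    by (intro span_diff span.scale)
  also have "x * L - scal (v c) * x ^ ?m - scal (v c) * L
      = (\<Prod>c\<leftarrow>c # cs. x - scal (v c)) - x ^ length (c # cs)"
    by (simp add: L_def algebra_simps)
  finally show ?case by simp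
qed (auto intro: span.ideal)

text \<open>The product of linear factors is monic of degree \<open>r\<close> and lies in the ideal,
  which rewrites \<open>t_k^r\<close> by lower powers. The range \<open>e \<le> r\<close> suffices
  because monomials grow by one factor at a time.\<close>

lemma t_power_span:
  assumes "1 \<le> k" "k \<le> n" "e \<le> r"
  shows "t k ^ e \<in> span ((\<lambda>e. t k ^ e) ` {..<r})"
proof (cases "e = r")
  case True
  let ?P = "\<Prod>c\<leftarrow>[1..<r+1]. t k - scal (u c)"
  have "?P - t k ^ r \<in> span ((\<lambda>e. t k ^ e) ` {..<r})"
    using prod_linear_factors[of "t k" u "[1..<r+1]"] assms by (simp del: upt_Suc)
  moreover have "?P \<in> span ((\<lambda>e. t k ^ e) ` {..<r})"
    using t_char_poly[OF assms(1,2)] by (rule span.ideal)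
  ultimately have "?P - (?P - t k ^ r) \<in> span ((\<lambda>e. t k ^ e) ` {..<r})"
    by (rule span_diff[rotated])
  then show ?thesis by (simp add: True)
next
  case False
  with assms show ?thesis by (intro span.base) auto
qed

lemma commute_prod_list:
  assumes "a \<in> carr" "set xs \<subseteq> carr" "\<And>x. x \<in> set xs \<Longrightarrow> a * x \<approx> x * a"
  shows "a * prod_list xs \<approx> prod_list xs * a"
  using assms(2,3)
proof (induction xs)
  case (Cons x xs)
  have "(a * x) * prod_list xs \<approx> (x * a) * prod_list xs"
    using Cons by (intro eqv_mult_right) auto
  also have "(x * a) * prod_list xs = x * (a * prod_list xs)" by (simp add: mult.assoc)
  also have "\<dots> \<approx> x * (prod_list xs * a)"
    using Cons by (intro eqv_mult_left) auto
  finally show ?case by (simp add: mult.assoc)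
qed simp

definition t_mon :: "(nat \<Rightarrow> nat) \<Rightarrow> 'r ncser" where
  "t_mon c = (\<Prod>i\<leftarrow>[1..<n+1]. t i ^ c i)"

text \<open>\<open>t k\<close> is carried to its own slot, where the exponent grows by one and, on
  reaching \<open>r\<close>, is reduced again; the factors on either side are untouched.\<close>

lemma t_mult_t_mon:
  assumes k: "1 \<le> k" "k \<le> n" and c: "c \<in> exponents"
  shows "t k * t_mon c \<in> span (t_mon ` exponents)"
proof -
  let ?A = "\<Prod>i\<leftarrow>[1..<k]. t i ^ c i" and ?B = "\<Prod>i\<leftarrow>[Suc k..<n+1]. t i ^ c i"
  have split: "[1..<n+1] = [1..<k] @ k # [Suc k..<n+1]"
  proof -
    have "k # [Suc k..<n+1] = [k..<n+1]" using k by (intro upt_conv_Cons[symmetric]) simp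
    then show ?thesis using k by (simp only: upt_split[of 1 k "n+1"])
  qed
  \<comment> \<open>The parameter \<open>e\<close> covers both the original monomial, with
    \<open>e = c k\<close>, and those that arise from rewriting
    \<open>t k ^ Suc (c k)\<close>.\<close>
  have mon: "?A * (t k ^ e * ?B) = t_mon (c(k := e))" for e
  proof -
    have "(\<Prod>i\<leftarrow>[1..<k]. t i ^ (c(k := e)) i) = ?A" "(\<Prod>i\<leftarrow>[Suc k..<n+1]. t i ^ (c(k := e)) i) = ?B"
      by (intro arg_cong[where f = prod_list] map_cong; simp del: upt_Suc)+
    then show ?thesis unfolding t_mon_def split by simp
  qed
  have A: "?A \<in> carr" using k by (intro carr_prod_list) auto
  have B: "?B \<in> carr" using k by (intro carr_prod_list) (auto simp del: upt_Suc)
  have pow: "t k * t i ^ e \<approx> t i ^ e * t k" if "1 \<le> i" "i \<le> n" for i e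
  proof -
    have "t k * prod_list (replicate e (t i)) \<approx> prod_list (replicate e (t i)) * t k"
      using that k by (intro commute_prod_list) (auto intro!: t_commute)
    then show ?thesis by simp
  qed
  have "t k * ?A \<approx> ?A * t k"
    using k by (intro commute_prod_list) (auto intro!: pow)
  then have "(t k * ?A) * (t k ^ c k * ?B) \<approx> (?A * t k) * (t k ^ c k * ?B)"
    using k B by (intro eqv_mult_right) auto
  also have "(t k * ?A) * (t k ^ c k * ?B) = t k * t_mon c"
    using mon[of "c k"] by (simp add: mult.assoc)
  also have "(?A * t k) * (t k ^ c k * ?B) = ?A * (t k ^ Suc (c k) * ?B)"
    by (simp add: mult.assoc)
  finally have eqv: "t k * t_mon c \<approx> ?A * (t k ^ Suc (c k) * ?B)" .
  have "c k < r" using c k by (auto simp: PiE_iff)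
  then have "t k ^ Suc (c k) \<in> span ((\<lambda>e. t k ^ e) ` {..<r})"
    using k by (intro t_power_span) auto
  then have "t k ^ Suc (c k) * ?B \<in> span ((\<lambda>e. t k ^ e * ?B) ` {..<r})"
    using B by (rule span_mult_right) (auto intro: span.base)
  then have "?A * (t k ^ Suc (c k) * ?B) \<in> span (t_mon ` exponents)"
  proof (rule span_mult_left[OF _ A])
    fix s assume "s \<in> (\<lambda>e. t k ^ e * ?B) ` {..<r}"
    then obtain e where e: "e < r" "s = t k ^ e * ?B" by auto
    have "c(k := e) \<in> exponents" using c e k by (auto simp: PiE_iff extensional_def)
    then show "?A * s \<in> span (t_mon ` exponents)" unfolding e(2) mon by (intro span.base imageI)
  qed
  with eqv show ?thesis by (rule span_eqv)
qed

lemma one_in_t_mon: "1 \<in> t_mon ` exponents"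
proof (rule image_eqI[of _ _ "restrict (\<lambda>_. 0) {1..n}"])
  have "(\<Prod>i\<leftarrow>[1..<n+1]. t i ^ restrict (\<lambda>_. 0) {1..n} i) = (\<Prod>i\<leftarrow>[1..<n+1]. 1)"
    by (intro arg_cong[where f = prod_list] map_cong) (auto simp del: upt_Suc)
  also have "\<dots> = 1" by (simp add: map_replicate_const del: upt_Suc)
  finally show "1 = t_mon (restrict (\<lambda>_. 0) {1..n})" by (simp add: t_mon_def)
qed (use r in auto)

lemma t_words_span_t_mon:
  assumes "x \<in> t_words"
  shows "x \<in> span (t_mon ` exponents)"
proof -
  obtain w where "set w \<subseteq> {1..n}" "x = t_word w" using assms by (auto simp: t_words_def)
  then show ?thesis
  proof (induction w arbitrary: x)
    case Nil
    then show ?case using span.base[OF one_in_t_mon] by (simp add: t_word_def)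
  next
    case (Cons k w)
    then have k: "1 \<le> k" "k \<le> n" and w: "t_word w \<in> span (t_mon ` exponents)" by auto
    have "t k * t_word w \<in> span (t_mon ` exponents)"
      using w t_carr[OF k] by (rule span_mult_left) (use t_mult_t_mon[OF k] in blast)
    with Cons.prems show ?case by (simp add: t_word_def)
  qed
qed

section \<open>Normal words span the products of the \<open>T\<close>\<close>

definition T_word :: "nat list \<Rightarrow> 'r ncser" where
  "T_word l = (\<Prod>i\<leftarrow>l. T i)"

lemma T_word_Cons [simp]: "T_word (i # l) = T i * T_word l"
  and T_word_append: "T_word (l @ l') = T_word l * T_word l'"
  by (simp_all add: T_word_def)

lemma T_word_carr [simp]: "set l \<subseteq> {1..<n} \<Longrightarrow> T_word l \<in> carr"
  unfolding T_word_def by (intro carr_prod_list) auto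

lemma T_commute_word:
  assumes "1 \<le> i" "i < n" "set l \<subseteq> {1..<n}" "\<And>j. j \<in> set l \<Longrightarrow> i + 2 \<le> j \<or> j + 2 \<le> i"
  shows "T i * T_word l \<approx> T_word l * T i"
  unfolding T_word_def
proof (rule commute_prod_list)
  show "T i * x \<approx> x * T i" if "x \<in> set (map T l)" for x
  proof -
    obtain j where j: "j \<in> set l" "x = T j" using \<open>x \<in> set (map T l)\<close> by auto
    then show ?thesis using assms(3) assms(4)[of j] unfolding j(2)
      by (intro T_commute assms) auto
  qed
qed (use assms in auto)

lemma T_mult_normal_word:
  assumes "m < n" "l \<in> normal_words m" "1 \<le> i" "i \<le> m"
  shows "T i * T_word l \<in> span (T_word ` normal_words m)"
  using assms
proof (induction m arbitrary: i l)
  case (Suc m)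
  let ?N = "Suc (Suc m)"
  let ?S = "T_word ` normal_words (Suc m)"
  obtain j l' where l: "l = [j..<?N] @ l'" "1 \<le> j" "j \<le> ?N" "l' \<in> normal_words m"
    using Suc.prems(2) by (auto simp del: upt_Suc)
  let ?y = "T_word l'"
  have l'set: "set l' \<subseteq> {1..<n}" using set_normal_word[OF l(4)] Suc.prems(1) by fastforce
  have i: "1 \<le> i" "i < n" using Suc.prems by auto
  have cycle: "T_word [k..<?N] * T_word v \<in> ?S" if "1 \<le> k" "k \<le> ?N" "v \<in> normal_words m" for k v
    unfolding T_word_append[symmetric] using that by (intro imageI) (auto simp del: upt_Suc)
  have cycle_carr: "T_word [k..<?N] \<in> carr" if "1 \<le> k" for k
    using that Suc.prems(1) by (intro T_word_carr) auto
  have cycle_span: "T_word [k..<?N] * z \<in> span ?S"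
    if "1 \<le> k" "k \<le> ?N" "z \<in> span (T_word ` normal_words m)" for k z
  proof (rule span_mult_left[OF that(3) cycle_carr[OF that(1)]])
    fix s assume "s \<in> T_word ` normal_words m"
    then obtain v where "v \<in> normal_words m" "s = T_word v" by blast
    then show "T_word [k..<?N] * s \<in> span ?S" using cycle[OF that(1,2)] span.base by blast
  qed
  have IH: "T k * ?y \<in> span (T_word ` normal_words m)" if "1 \<le> k" "k \<le> m" for k
    using that Suc.IH[OF _ l(4)] Suc.prems(1) by simp
  have Tl: "T_word l = T_word [j..<?N] * ?y" by (simp add: l T_word_append del: upt_Suc)
  have split_first: "T_word [k..<?N] = T k * T_word [Suc k..<?N]" if "k < ?N" for k
    using that by (simp add: upt_conv_Cons del: upt_Suc)
  consider "Suc i < j" | "Suc i = j" | "i = j" | "j < i" by linarith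
  then show ?case
  proof cases
    case 1
    have "T i * T_word [j..<?N] \<approx> T_word [j..<?N] * T i"
      using 1 i Suc.prems(1) by (intro T_commute_word) auto
    then have "(T i * T_word [j..<?N]) * ?y \<approx> (T_word [j..<?N] * T i) * ?y"
      using l'set by (intro eqv_mult_right) auto
    moreover have "T_word [j..<?N] * (T i * ?y) \<in> span ?S"
      using 1 i l by (intro cycle_span IH) auto
    ultimately show ?thesis unfolding Tl by (simp add: mult.assoc span_eqv del: upt_Suc)
  next
    case 2
    then have "T i * T_word l = T_word [i..<?N] * ?y"
      using l(3) by (simp add: Tl split_first mult.assoc del: upt_Suc)
    moreover have "T_word [i..<?N] * ?y \<in> ?S" using i l(3,4) 2 by (intro cycle) auto
    ultimately show ?thesis by (simp only: span.base)
  next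
    case 3
    have B: "T_word [Suc i..<?N] * ?y \<in> carr" using l'set cycle_carr[of "Suc i"] by simp
    have "i < ?N" using 3 Suc.prems by simp
    then have "T i * T_word l = (T i * T i) * (T_word [Suc i..<?N] * ?y)"
      unfolding Tl 3[symmetric] by (simp add: split_first mult.assoc del: upt_Suc)
    also have "\<dots> \<approx> (scal h * T i + 1) * (T_word [Suc i..<?N] * ?y)"
      using B i by (intro eqv_mult_right T_square)
    also have "\<dots> = scal h * (T_word [i..<?N] * ?y) + T_word [Suc i..<?N] * ?y"
      using \<open>i < ?N\<close> by (simp add: split_first distrib_right mult.assoc del: upt_Suc)
    finally show ?thesis
      by (rule span_eqv) (use i \<open>i < ?N\<close> l(4) in \<open>intro span.add span.scale span.base cycle; simp\<close>)
  next
    case 4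
    \<comment> \<open>The cycle contains the consecutive letters \<open>k\<close> and
      \<open>i\<close>. \<open>T_i\<close> commutes with the letters before \<open>k\<close>, braids
      with \<open>T_k T_i\<close>, and emerges as \<open>T_k\<close>, which commutes with the
      letters after \<open>i\<close>.\<close>
    define k where "k = i - 1"
    have k: "i = Suc k" "1 \<le> k" "j \<le> k" "k < n" "k \<le> m" using 4 l(2) i Suc.prems by (auto simp: k_def)
    let ?A = "T_word [j..<k]" and ?B = "T_word [Suc i..<?N]"
    have A: "?A \<in> carr" using l(2) k by (intro T_word_carr) auto
    have B: "?B \<in> carr" by (rule cycle_carr) simp
    have y: "?y \<in> carr" using l'set by simp
    have "[j..<?N] = [j..<k] @ [k..<?N]" using k Suc.prems by (intro upt_split) auto
    also have "[k..<?N] = k # i # [Suc i..<?N]"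
      using k Suc.prems by (simp add: upt_conv_Cons del: upt_Suc)
    finally have W: "T_word [j..<?N] = ?A * (T k * (T i * ?B))"
      by (simp add: T_word_append del: upt_Suc)
    have c1: "T i * ?A \<approx> ?A * T i"
      using i k l(2) by (intro T_commute_word) auto
    have c2: "T k * ?B \<approx> ?B * T k"
      using k Suc.prems(1) by (intro T_commute_word) auto
    have braid: "T i * (T k * T i) \<approx> T k * (T i * T k)"
      using eqv_sym[OF T_braid[OF k(2)]] i k(1) by simp
    have "T i * T_word [j..<?N] = (T i * ?A) * (T k * (T i * ?B))"
      by (simp add: W mult.assoc del: upt_Suc)
    also have "\<dots> \<approx> (?A * T i) * (T k * (T i * ?B))"
      using c1 by (rule eqv_mult_right) (use i k B in simp)
    also have "\<dots> = ?A * ((T i * (T k * T i)) * ?B)" by (simp add: mult.assoc)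
    also have "\<dots> \<approx> ?A * ((T k * (T i * T k)) * ?B)"
      by (intro eqv_mult_left eqv_mult_right braid A B)
    also have "\<dots> = (?A * (T k * T i)) * (T k * ?B)" by (simp add: mult.assoc)
    also have "\<dots> \<approx> (?A * (T k * T i)) * (?B * T k)"
      using c2 by (rule eqv_mult_left) (use A k i in simp)
    also have "\<dots> = T_word [j..<?N] * T k" by (simp add: W mult.assoc del: upt_Suc)
    finally have "(T i * T_word [j..<?N]) * ?y \<approx> (T_word [j..<?N] * T k) * ?y"
      using y by (rule eqv_mult_right)
    moreover have "T_word [j..<?N] * (T k * ?y) \<in> span ?S"
      using k l by (intro cycle_span IH) auto
    ultimately show ?thesis unfolding Tl by (simp add: mult.assoc span_eqv del: upt_Suc)
  qed
qed simp

lemma Nil_normal_word: "[] \<in> normal_words m"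
  by (induction m) (force simp: image_iff)+

abbreviation t_T_mon :: "(nat \<Rightarrow> nat) \<times> nat list \<Rightarrow> 'r ncser" where
  "t_T_mon \<equiv> \<lambda>(c, l). t_mon c * T_word l"

lemma t_mon_span_t_words: "t_mon c \<in> span t_words"
proof -
  have "(\<Prod>i\<leftarrow>w. t i ^ c i) \<in> span t_words" if "set w \<subseteq> {1..n}" for w
    using that
  proof (induction w)
    case (Cons k w)
    then have "t k ^ c k \<in> span t_words" by (intro span_t_words_power span.base t_in_t_words) auto
    then have "t k ^ c k * (\<Prod>i\<leftarrow>w. t i ^ c i) \<in> span t_words"
      using Cons by (intro span_t_words_mult) auto
    then show ?case by simp
  qed (simp add: span.base one_in_t_words)
  then show ?thesis unfolding t_mon_def by (metis set_upt_Suc order_refl)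
qed

text \<open>The span of the normal forms contains 1 and is closed under left multiplication by each
  generator. For \<open>T_i\<close> the monomial is loosened to \<open>t_words\<close> and sorted
  again once \<open>T_i\<close> has been absorbed by the normal word.\<close>

lemma word_span:
  assumes "\<forall>g\<in>set w. valid_gen n g"
  shows "(\<Prod>g\<leftarrow>w. gen g) \<in> span (t_T_mon ` (exponents \<times> normal))"
  using assms
proof (induction w)
  case Nil
  obtain c where "c \<in> exponents" "1 = t_mon c" using one_in_t_mon by blast
  then have "1 \<in> t_T_mon ` (exponents \<times> normal)"
    by (intro image_eqI[of _ _ "(c, [])"]) (auto simp: Nil_normal_word T_word_def)
  then show ?case by (simp add: span.base del: One_nat_def)
next
  case (Cons g w)
  let ?S = "t_T_mon ` (exponents \<times> normal)"
  have l_carr: "T_word l \<in> carr" if "l \<in> normal" for l using normal_props(1)[OF that] by simp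
  have mon_word: "x * T_word l \<in> span ?S" if "x \<in> t_words" "l \<in> normal" for x l
    using t_words_span_t_mon[OF that(1)] l_carr[OF that(2)]
    by (rule span_mult_right) (use that(2) in \<open>auto intro!: span.base\<close>)
  have step: "gen g * s \<in> span ?S" if s: "s \<in> ?S" for s
  proof -
    obtain c l where s: "s = t_mon c * T_word l" and c: "c \<in> exponents" and l: "l \<in> normal"
      using s by auto
    have "(gen g * t_mon c) * T_word l \<in> span ?S"
    proof (cases g)
      case (Gt k)
      then have "gen g * t_mon c \<in> span (t_mon ` exponents)"
        using t_mult_t_mon[OF _ _ c] Cons.prems by (auto simp: valid_gen_def)
      then show ?thesis
        using l_carr[OF l] by (rule span_mult_right) (use l in \<open>auto intro!: span.base\<close>)
    next
      case (GT i)
      then have i: "1 \<le> i" "i < n" using Cons.prems by (auto simp: valid_gen_def)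
      have "gen g * t_mon c \<in> span ((\<lambda>x. x * T i) ` t_words \<union> t_words)"
        unfolding GT using t_mon_span_t_words T_carr[OF i] by (rule span_mult_left) (rule T_t_word[OF i])
      then show ?thesis
      proof (rule span_mult_right[OF _ l_carr[OF l]])
        fix z assume "z \<in> (\<lambda>x. x * T i) ` t_words \<union> t_words"
        then consider x where "x \<in> t_words" "z = x * T i" | "z \<in> t_words" by blast
        then show "z * T_word l \<in> span ?S"
        proof cases
          case (1 x)
          have "T i * T_word l \<in> span (T_word ` normal)"
            using i l by (intro T_mult_normal_word) auto
          then have "x * (T i * T_word l) \<in> span ?S"
            using t_words_carr[OF 1(1)] by (rule span_mult_left) (use mon_word[OF 1(1)] in auto)
          then show ?thesis by (simp add: 1 mult.assoc)
        qed (use mon_word[OF _ l] in simp)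
      qed
    qed
    then show ?thesis by (simp add: s mult.assoc)
  qed
  have "(\<Prod>g\<leftarrow>w. gen g) \<in> span ?S" using Cons by simp
  moreover have "gen g \<in> carr" using Cons.prems by simp
  ultimately have "gen g * (\<Prod>g\<leftarrow>w. gen g) \<in> span ?S" by (rule span_mult_left) (rule step)
  then show ?case by simp
qed

lemma carrier_span:
  assumes p: "p \<in> fa_carrier n"
  shows "ser p \<in> span (t_T_mon ` (exponents \<times> normal))"
proof -
  have fin: "finite {w. p w \<noteq> 0}" using p by (rule fa_carrier_finite)
  have "ser p = (\<Sum>w | p w \<noteq> 0. scal (p w) * (\<Prod>g\<leftarrow>w. gen g))"
    by (subst fa_expand[OF fin]) (simp add: ser_sum[OF fin] ser_simps comp_def)
  also have "\<dots> \<in> span (t_T_mon ` (exponents \<times> normal))"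
    using p by (intro span_sum span.scale word_span) (auto simp: fa_carrier_def)
  finally show ?thesis .
qed

lemma ser_T_mon: "ser (T_mon i) = t_T_mon i"
  by (cases i) (simp add: T_mon_def t_power_def t_mon_def T_word_def ser_simps comp_def del: upt_Suc)

lemma T_mon_spanning:
  assumes "p \<in> fa_carrier n"
  shows "\<exists>a. fa_minus p (fa_sum (\<lambda>i. fa_smul (a i) (T_mon i)) (exponents \<times> normal)) \<in> H_ideal n r q u"
proof -
  have fin: "finite (exponents \<times> normal)" by (intro finite_cartesian_product finite_exponents finite_normal_words)
  obtain a where "ser p \<approx> (\<Sum>i\<in>exponents \<times> normal. scal (a i) * t_T_mon i)"
    using span_finite_image[OF carrier_span[OF assms] fin] by blast
  also have "(\<Sum>i\<in>exponents \<times> normal. scal (a i) * t_T_mon i)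
      = ser (fa_sum (\<lambda>i. fa_smul (a i) (T_mon i)) (exponents \<times> normal))"
    by (simp add: ser_sum[OF fin] ser_smul ser_T_mon del: One_nat_def)
  finally show ?thesis unfolding eqv_def ser_minus[symmetric] ser_ideal by blast
qed

end

theorem theorem3p9:
  fixes n r :: nat and q :: "'r::idom" and u :: "nat \<Rightarrow> 'r"
  assumes "1 \<le> n" and "1 \<le> r" and "q dvd 1" and "Delta r u dvd 1"
  shows "(\<forall>x\<in>fa_carrier n. \<exists>a. fa_minus x (fa_sum (\<lambda>i. fa_smul (a i) (mon n r q u i)) (Idx n r))
              \<in> H_ideal n r q u)
       \<and> (\<forall>a. fa_sum (\<lambda>i. fa_smul (a i) (mon n r q u i)) (Idx n r) \<in> H_ideal n r q u
              \<longrightarrow> (\<forall>i\<in>Idx n r. a i = 0))"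
proof -
  interpret shoji n r q u using assms by unfold_locales
  \<comment> \<open>The state coloured by \<open>k\<close> and labelled by \<open>inv w\<close>, the
    labelling on which \<open>g_w v0\<close> lives.\<close>
  have pair: "(\<lambda>i. (k i, inv w i)) \<in> states" "fst \<circ> (\<lambda>i. (k i, inv w i)) = k"
    "inv (snd \<circ> (\<lambda>i. (k i, inv w i))) = w"
    if "k \<in> colourings" "w permutes {1..n}" for k w
    using state_of_pair[OF that(1) permutes_inv[OF that(2)]] permutes_inv_inv[OF that(2)]
    by (simp_all add: comp_def)
  let ?sum = "\<lambda>a. fa_sum (\<lambda>i. fa_smul (a i) (mon n r q u i)) (Idx n r)"
  have carrier: "?sum a \<in> fa_carrier n" for a
    by (simp add: mon_carrier)
  have "\<exists>a. fa_minus x (?sum a) \<in> H_ideal n r q u" if x: "x \<in> fa_carrier n" for x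
  proof -
    let ?\<phi> = "\<lambda>w k. act x v0 (\<lambda>i. (k i, inv w i))"
    \<comment> \<open>For each \<open>w\<close> the values of \<open>x v0\<close> on the states
      labelled by \<open>inv w\<close> are the right-hand side of a Vandermonde system, whose
      solution gives the coefficients of the \<open>t^c g_w\<close>.\<close>
    have "\<forall>w. \<exists>b. \<forall>k\<in>colourings. (\<Sum>c\<in>exponents. b c * vandermonde c k) = ?\<phi> w k"
      by (intro allI vandermonde_surjective)
    from choice[OF this] obtain b
      where b: "\<forall>w. \<forall>k\<in>colourings. (\<Sum>c\<in>exponents. b w c * vandermonde c k) = ?\<phi> w k"
      by (rule exE)
    define y where "y = fa_minus x (?sum (\<lambda>(c, w). b w c))"
    have y: "y \<in> fa_carrier n" unfolding y_def using x carrier by simp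
    have y_zero: "act y v0 s = 0" if s: "s \<in> states" for s
    proof -
      have "snd \<circ> s permutes {1..n}" and k: "fst \<circ> s \<in> colourings" using s by (auto simp: states_def)
      then have "(\<lambda>i. ((fst \<circ> s) i, inv (inv (snd \<circ> s)) i)) = s" by (simp add: permutes_inv_inv)
      then show ?thesis
        unfolding y_def using x carrier b[rule_format, OF k, of "inv (snd \<circ> s)"]
        by (simp add: act_simps act_sum_mon[OF s] del: One_nat_def)
    qed
    let ?Tsum = "\<lambda>d. fa_sum (\<lambda>i. fa_smul (d i) (T_mon i)) (exponents \<times> normal)"
    obtain d where d: "fa_minus y (?Tsum d) \<in> H_ideal n r q u"
      using T_mon_spanning[OF y] by blast
    have Tc: "?Tsum d \<in> fa_carrier n" by (intro fa_carrier_sum fa_carrier_smul T_mon_carrier)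
    \<comment> \<open>\<open>y\<close> kills \<open>v0\<close> and differs from its normal form by
      an element of the ideal, so the normal form kills \<open>v0\<close> too. Independence then
      makes every \<open>d i\<close> vanish, which leaves \<open>y\<close> itself in the
      ideal.\<close>
    have "act (?Tsum d) v0 s = 0" if s: "s \<in> states" for s
      using H_ideal_act(2)[OF d s, of v0] y_zero[OF s] act_minus[OF y Tc, of v0] by simp
    then have "\<forall>i\<in>exponents \<times> normal. d i = 0" using T_mon_independent by blast
    then have "?Tsum d = (\<lambda>_. 0)" unfolding fa_sum_def fa_smul_def by (intro ext sum.neutral) simp
    then have "y \<in> H_ideal n r q u" using d by (simp add: fa_minus_def)
    then show ?thesis unfolding y_def by blast
  qed
  moreover have "a i = 0" if a: "?sum a \<in> H_ideal n r q u" and i: "i \<in> Idx n r" for a i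
  proof -
    obtain c w where cw: "i = (c, w)" "c \<in> exponents" "w permutes {1..n}" using i by (auto simp: Idx_def)
    \<comment> \<open>Evaluation at the states labelled by \<open>inv w\<close> isolates the
      coefficients belonging to this \<open>w\<close>.\<close>
    have "(\<Sum>c\<in>exponents. a (c, w) * vandermonde c k) = 0" if k: "k \<in> colourings" for k
      using H_ideal_act(2)[OF a pair(1)[OF k cw(3)], of v0] act_sum_mon[OF pair(1)[OF k cw(3)], of a]
      unfolding pair[OF k cw(3)] by simp
    then have "a (c, w) = 0" using cw(2) by (rule vandermonde_independent)
    with cw show ?thesis by simp
  qed
  ultimately show ?thesis by blast
qed

end
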